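(* Let $0<\rho<1/2$. (a) Let $\eta_0\in X_\rho$ and let $\eta_\infty=\lim_{t\to\infty}U^t\eta_0$ be its (pointwise, existing) limit under the F-TASEP dynamics $U$. Then the modified TASEP evolution $(\tau T_L)^t\eta_0$ also converges pointwise as $t\to\infty$ to the same configuration $\eta_\infty$. (b) For every translation invariant probability measure $\lambda$ on $X$ with $\lambda(X_\rho)=1$, let $\lambda_\infty=\lim_{t\to\infty}U^t_*\lambda$ (weak limit, which exists). Then $(T_L^t)_*\lambda\to\lambda_\infty$ and $(T_R^t)_*\lambda\to R_*\bigl((R_*\lambda)_\infty\bigr)$ weakly as $t\to\infty$. (c) In particular, let $\mu^{(\rho)}$ be the Bernoulli product measure of density $\rho$ and $\mu_\infty=\lim_{t\to\infty}U^t_*\mu^{(\rho)}$ the final F-TASEP state. For the deterministic discrete-time TASEP (with either direction of motion, $T=T_L$ or $T=T_R$), $(T^t)_*\mu^{(\rho)}\to\mu_\infty$, and $(T^t)_*\mu^{(1-\rho)}\to C_*\mu_\infty$, weakly as $t\to\infty$, where $C$ is the exchange of particles and holes.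
   Context: $X=\{0,1\}^{\mathbb Z}$ ($1$ = particle, $0$ = hole); $X_\rho$ is the set of $\eta\in X$ with $\lim_{N\to\infty}\frac1N\sum_{i=1}^N\eta(i)=\lim_{N\to\infty}\frac1N\sum_{i=-N}^{-1}\eta(i)=\rho$. F-TASEP step $U:X\to X$: simultaneously, every particle at a site $j$ with $\eta(j-1)=1$ and $\eta(j+1)=0$ moves to $j+1$. Deterministic discrete-time TASEP: in the left-moving version $T_L:X\to X$, simultaneously every particle whose left neighbor site is empty jumps to that site; in the right-moving version $T_R:X\to X$, simultaneously every particle whose right neighbor site is empty jumps to that site. $\tau$ is translation to the right by one site, $(\tau\eta)(k)=\eta(k-1)$; $R:X\to X$ is reflection, $(R\eta)(k)=\eta(-k)$; $C:X\to X$ is $(C\eta)(k)=1-\eta(k)$. For a measure $\lambda$ and map $f$, $f_*\lambda=\lambda\circ f^{-1}$. *)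

theory Defs
  imports "HOL-Probability.Probability"
begin

text \<open>
  \<open>X = {0,1}\<^sup>\<int>\<close>, with True for a particle and False for a hole. Its topology is the library's
  topology on function types, i.e. the product of the discrete topologies; its
  \<open>\<sigma>\<close>-algebra is \<open>borel\<close>.
\<close>
type_synonym config = "int \<Rightarrow> bool"

definition density_configs :: "real \<Rightarrow> config set" where
  "density_configs \<rho> = {\<eta>.
     (\<lambda>N::nat. (\<Sum>i\<in>{1..int N}. of_bool (\<eta> i)) / real N) \<longlonglongrightarrow> \<rho> \<and>
     (\<lambda>N::nat. (\<Sum>i\<in>{- int N..-1}. of_bool (\<eta> i)) / real N) \<longlonglongrightarrow> \<rho>}"

definition ftasep_jumps :: "config \<Rightarrow> int \<Rightarrow> bool" where
  "ftasep_jumps \<eta> j \<longleftrightarrow> \<eta> j \<and> \<eta> (j - 1) \<and> \<not> \<eta> (j + 1)"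

definition tasepL_jumps :: "config \<Rightarrow> int \<Rightarrow> bool" where
  "tasepL_jumps \<eta> j \<longleftrightarrow> \<eta> j \<and> \<not> \<eta> (j - 1)"

definition tasepR_jumps :: "config \<Rightarrow> int \<Rightarrow> bool" where
  "tasepR_jumps \<eta> j \<longleftrightarrow> \<eta> j \<and> \<not> \<eta> (j + 1)"

text \<open>
  After a simultaneous update, a site is occupied iff its own particle did not jump away
  or a particle jumped onto it.
\<close>
definition ftasep :: "config \<Rightarrow> config" where
  "ftasep \<eta> = (\<lambda>k. (\<eta> k \<and> \<not> ftasep_jumps \<eta> k) \<or> ftasep_jumps \<eta> (k - 1))"

definition tasepL :: "config \<Rightarrow> config" where
  "tasepL \<eta> = (\<lambda>k. (\<eta> k \<and> \<not> tasepL_jumps \<eta> k) \<or> tasepL_jumps \<eta> (k + 1))"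

definition tasepR :: "config \<Rightarrow> config" where
  "tasepR \<eta> = (\<lambda>k. (\<eta> k \<and> \<not> tasepR_jumps \<eta> k) \<or> tasepR_jumps \<eta> (k - 1))"

definition translate :: "config \<Rightarrow> config" where
  "translate \<eta> = (\<lambda>k. \<eta> (k - 1))"

definition reflect :: "config \<Rightarrow> config" where
  "reflect \<eta> = (\<lambda>k. \<eta> (- k))"

definition exchange :: "config \<Rightarrow> config" where
  "exchange \<eta> = (\<lambda>k. \<not> \<eta> k)"

definition pointwise_limit :: "(nat \<Rightarrow> config) \<Rightarrow> config \<Rightarrow> bool" where
  "pointwise_limit \<zeta> \<eta> \<longleftrightarrow> (\<forall>k. (\<lambda>t. \<zeta> t k) \<longlonglongrightarrow> \<eta> k)"

definition config_prob :: "config measure \<Rightarrow> bool" where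
  "config_prob \<nu> \<longleftrightarrow> prob_space \<nu> \<and> sets \<nu> = sets borel"

definition push :: "(config \<Rightarrow> config) \<Rightarrow> config measure \<Rightarrow> config measure" where
  "push f \<nu> = distr \<nu> borel f"

definition translation_invariant :: "config measure \<Rightarrow> bool" where
  "translation_invariant \<nu> \<longleftrightarrow> push translate \<nu> = \<nu>"

text \<open>
  The library's \<open>weak_conv_m\<close> only covers measures on the real line, so weak convergence of
  probability measures is defined here by integrals of bounded continuous functions.
\<close>
definition weak_limit :: "(nat \<Rightarrow> config measure) \<Rightarrow> config measure \<Rightarrow> bool" where
  "weak_limit M L \<longleftrightarrow>
     (\<forall>t. config_prob (M t)) \<and> config_prob L \<and>
     (\<forall>f :: config \<Rightarrow> real. continuous_on UNIV f \<longrightarrow> bounded (range f) \<longrightarrow>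
        (\<lambda>t. integral\<^sup>L (M t) f) \<longlonglongrightarrow> integral\<^sup>L L f)"

definition bernoulli_measure :: "real \<Rightarrow> config measure" where
  "bernoulli_measure \<rho> = (\<Pi>\<^sub>M k\<in>UNIV. measure_pmf (bernoulli_pmf \<rho>))"

end

theory Submission
  imports Defs
begin

text \<open>
  Encode a configuration by a height function \<open>h\<close> with increments \<open>+1\<close> at particles and \<open>-1\<close> at
  holes. Then \<open>translate \<circ> tasepL\<close> acts as \<open>h j \<mapsto> min (h j) (h (j - 2))\<close>, and the facilitated step
  does the same but only at sites followed by a hole. Both decrease \<open>h\<close> to
  \<open>min {h (j - 2 s) | s \<ge> 0}\<close>, the facilitated one because its fixed points contain no \<open>110\<close> and the
  drift of \<open>h\<close> forbids an infinite run of particles. If \<open>Q j = max {h j - h i | i \<le> j}\<close> is the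
  queue length with particles as arrivals and holes as services, the limit configuration is
  occupied at \<open>j\<close> iff \<open>Q j\<close> is odd.

  Under a Bernoulli measure the queue is a stationary birth-death chain, hence reversible, so the
  law of the limit configuration is invariant under reflection; this is why both directions of
  motion have the same limit.
\<close>

subsection \<open>Heights and the queue\<close>

definition spin :: "config \<Rightarrow> int \<Rightarrow> int" where
  "spin \<eta> j = (if \<eta> j then 1 else -1)"

definition back_sum :: "config \<Rightarrow> int \<Rightarrow> nat \<Rightarrow> int" where
  "back_sum \<eta> j n = (\<Sum>i<n. spin \<eta> (j - int i))"

text \<open>Fixed only up to an additive constant. A normalisation such as \<open>h 0 = 0\<close>
  would not survive the lowering steps below.\<close>

definition is_height :: "(int \<Rightarrow> int) \<Rightarrow> config \<Rightarrow> bool" where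
  "is_height h \<eta> \<longleftrightarrow> (\<forall>j. h j = h (j - 1) + spin \<eta> j)"

text \<open>The supremum of \<open>back_sum \<eta> j\<close>; meaningful only if that is finite, i.e. under \<open>queue_stable\<close>.\<close>
definition queue :: "config \<Rightarrow> int \<Rightarrow> nat" where
  "queue \<eta> j = (LEAST q. \<forall>n. back_sum \<eta> j n \<le> int q)"

definition queue_stable :: "config \<Rightarrow> bool" where
  "queue_stable \<eta> \<longleftrightarrow> (\<forall>j. \<exists>q::nat. \<forall>n. back_sum \<eta> j n \<le> int q)"

lemma back_sum_0 [simp]: "back_sum \<eta> j 0 = 0"
  by (simp add: back_sum_def)

lemma back_sum_Suc: "back_sum \<eta> j (Suc n) = spin \<eta> j + back_sum \<eta> (j - 1) n"
  unfolding back_sum_def by (subst sum.lessThan_Suc_shift) (simp add: algebra_simps)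

lemma is_heightD: "is_height h \<eta> \<Longrightarrow> h j = h (j - 1) + spin \<eta> j"
  unfolding is_height_def by blast

lemma is_height_back_sum:
  assumes "is_height h \<eta>"
  shows "h j - h (j - int n) = back_sum \<eta> j n"
proof (induction n arbitrary: j)
  case (Suc n)
  have "h j - h (j - int (Suc n)) = spin \<eta> j + (h (j - 1) - h (j - 1 - int n))"
    using is_heightD[OF assms, of j] by (simp add: algebra_simps)
  then show ?case by (simp add: Suc.IH back_sum_Suc)
qed simp

lemma is_height_exists: "\<exists>h. is_height h \<eta>"
proof -
  \<comment> \<open>Since \<open>nat\<close> truncates at 0, at most one of the two terms is
    nonzero: the spins on \<open>1..j\<close> for positive \<open>j\<close>, minus those on
    \<open>j + 1..0\<close> for negative \<open>j\<close>.\<close>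
  define h where "h = (\<lambda>j. back_sum \<eta> j (nat j) - back_sum \<eta> 0 (nat (- j)))"
  have "h j = h (j - 1) + spin \<eta> j" for j
  proof (cases "j \<ge> 1")
    case True
    then have "nat j = Suc (nat (j - 1))" by simp
    with True show ?thesis by (simp add: h_def back_sum_Suc)
  next
    case False
    then have "nat (- (j - 1)) = Suc (nat (- j))" by simp
    moreover have "back_sum \<eta> 0 (Suc (nat (- j))) = back_sum \<eta> 0 (nat (- j)) + spin \<eta> j"
      using False by (simp add: back_sum_def)
    ultimately show ?thesis using False by (simp add: h_def)
  qed
  then show ?thesis unfolding is_height_def by blast
qed

text \<open>Moving the end point by one site inserts or removes a single spin, so a bound changes by
  at most 1. Hence a bound at one site spreads to all of them.\<close>

lemma back_sum_bounded_step:
  "(\<exists>q::nat. \<forall>n. back_sum \<eta> j n \<le> int q) \<longleftrightarrow> (\<exists>q::nat. \<forall>n. back_sum \<eta> (j - 1) n \<le> int q)"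
proof
  assume "\<exists>q::nat. \<forall>n. back_sum \<eta> j n \<le> int q"
  then obtain q :: nat where q: "back_sum \<eta> j n \<le> int q" for n by blast
  have "back_sum \<eta> (j - 1) n \<le> int (q + 1)" for n
    using q[of "Suc n"] by (simp add: back_sum_Suc spin_def split: if_splits)
  then show "\<exists>q::nat. \<forall>n. back_sum \<eta> (j - 1) n \<le> int q" by blast
next
  assume "\<exists>q::nat. \<forall>n. back_sum \<eta> (j - 1) n \<le> int q"
  then obtain q :: nat where q: "back_sum \<eta> (j - 1) n \<le> int q" for n by blast
  have "back_sum \<eta> j n \<le> int (q + 1)" for n
    using q[of "n - 1"] by (cases n) (simp_all add: back_sum_Suc spin_def)
  then show "\<exists>q::nat. \<forall>n. back_sum \<eta> j n \<le> int q" by blast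
qed

lemma queue_stableI:
  fixes q :: nat
  assumes "\<And>n. back_sum \<eta> a n \<le> int q"
  shows "queue_stable \<eta>"
  unfolding queue_stable_def
proof
  fix j
  show "\<exists>q::nat. \<forall>n. back_sum \<eta> j n \<le> int q"
  proof (induction j rule: int_induct[of _ a])
    case base
    then show ?case using assms by blast
  next
    case (step1 i)
    then show ?case using back_sum_bounded_step[of \<eta> "i + 1"] by simp
  next
    case (step2 i)
    then show ?case using back_sum_bounded_step[of \<eta> i] by simp
  qed
qed

text \<open>Characterises the queue by its upper bounds, so that later proofs avoid
  \<open>LEAST\<close>: two naturals with the same upper bounds are equal.\<close>

lemma queue_le_iff:
  assumes "queue_stable \<eta>"
  shows "queue \<eta> j \<le> q \<longleftrightarrow> (\<forall>n. back_sum \<eta> j n \<le> int q)"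
proof
  have ex: "\<exists>q::nat. \<forall>n. back_sum \<eta> j n \<le> int q"
    using assms by (auto simp: queue_stable_def)
  assume "queue \<eta> j \<le> q"
  moreover have "\<forall>n. back_sum \<eta> j n \<le> int (queue \<eta> j)"
    unfolding queue_def by (rule LeastI_ex[OF ex])
  ultimately show "\<forall>n. back_sum \<eta> j n \<le> int q"
    by (meson of_nat_mono order_trans)
next
  assume "\<forall>n. back_sum \<eta> j n \<le> int q"
  then show "queue \<eta> j \<le> q" unfolding queue_def by (rule Least_le)
qed

lemma back_sum_le_queue: "queue_stable \<eta> \<Longrightarrow> back_sum \<eta> j n \<le> int (queue \<eta> j)"
  using queue_le_iff by blast

text \<open>A finite supremum of integers is a maximum: a positive queue minus 1 is no longer an
  upper bound.\<close>

lemma queue_attained: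
  assumes "queue_stable \<eta>"
  shows "\<exists>n. back_sum \<eta> j n = int (queue \<eta> j)"
proof (cases "queue \<eta> j")
  case 0
  then show ?thesis by (intro exI[of _ 0]) simp
next
  case (Suc q)
  then have "\<not> queue \<eta> j \<le> q" by simp
  then obtain n where "back_sum \<eta> j n > int q"
    using queue_le_iff[OF assms] by (auto simp: not_le)
  then show ?thesis
    using back_sum_le_queue[OF assms, of j n] Suc by (intro exI[of _ n]) linarith
qed

text \<open>Lindley's recursion: particles are arrivals and holes are services.\<close>
lemma queue_step:
  assumes "queue_stable \<eta>"
  shows "queue \<eta> j = (if \<eta> j then queue \<eta> (j - 1) + 1 else queue \<eta> (j - 1) - 1)"
proof -
  \<comment> \<open>The empty sum only contributes \<open>0 \<le> q\<close>, so the supremum may be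
    taken over sums that contain site \<open>j\<close>.\<close>
  have le: "queue \<eta> j \<le> q \<longleftrightarrow> (\<forall>n. spin \<eta> j + back_sum \<eta> (j - 1) n \<le> int q)" for q
    unfolding queue_le_iff[OF assms]
    by (metis back_sum_0 back_sum_Suc not0_implies_Suc of_nat_0_le_iff)
  show ?thesis
  proof (cases "\<eta> j")
    case True
    have "queue \<eta> j \<le> q \<longleftrightarrow> queue \<eta> (j - 1) + 1 \<le> q" for q
    proof (cases q)
      case 0
      \<comment> \<open>The empty sum at \<open>j - 1\<close> already gives the value 1 at
        \<open>j\<close>, so after an arrival 0 is not an upper bound.\<close>
      have "\<not> 1 + back_sum \<eta> (j - 1) 0 \<le> int 0" by simp
      with 0 True show ?thesis unfolding le by (auto simp: spin_def simp del: back_sum_0)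
    next
      case (Suc p)
      with True show ?thesis
        using queue_le_iff[OF assms, of "j - 1" p] unfolding le by (simp add: spin_def)
    qed
    from this[of "queue \<eta> j"] this[of "queue \<eta> (j - 1) + 1"] True show ?thesis by simp
  next
    case False
    \<comment> \<open>Truncated subtraction is the intended one: a service at an empty queue leaves
      it empty.\<close>
    have "queue \<eta> j \<le> q \<longleftrightarrow> queue \<eta> (j - 1) - 1 \<le> q" for q
    proof -
      have "queue \<eta> j \<le> q \<longleftrightarrow> queue \<eta> (j - 1) \<le> q + 1"
        using False unfolding le queue_le_iff[OF assms, of "j - 1"]
        by (simp add: spin_def algebra_simps)
      then show ?thesis by linarith
    qed
    from this[of "queue \<eta> j"] this[of "queue \<eta> (j - 1) - 1"] False show ?thesis by simp
  qed
qed

lemma is_height_parity: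
  assumes "is_height h \<eta>"
  shows "even (h j - h (j - int n)) \<longleftrightarrow> even n"
proof (induction n)
  case (Suc n)
  have "h (j - int n) = h (j - int (Suc n)) + spin \<eta> (j - int n)"
    using is_heightD[OF assms, of "j - int n"] by (simp add: algebra_simps)
  then have "h j - h (j - int (Suc n)) = h j - h (j - int n) + spin \<eta> (j - int n)" by simp
  then have "even (h j - h (j - int (Suc n))) \<longleftrightarrow> (even (h j - h (j - int n)) \<longleftrightarrow> even (spin \<eta> (j - int n)))"
    by (simp only: even_add)
  moreover have "odd (spin \<eta> (j - int n))" by (simp add: spin_def)
  ultimately show ?case using Suc.IH by (simp only: even_Suc) blast
qed simp

subsection \<open>The final configuration\<close>

text \<open>\<open>h j - queue \<eta> j\<close> is the minimum of \<open>h\<close> on \<open>{..j}\<close>; rounding it up to the parity of \<open>h j\<close> gives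
  the minimum over \<open>j, j - 2, j - 4, \<dots>\<close>, the height of a configuration with particles where the
  queue is odd.\<close>
definition final_config :: "config \<Rightarrow> config" where
  "final_config \<eta> = (\<lambda>j. odd (queue \<eta> j))"

definition final_height :: "(int \<Rightarrow> int) \<Rightarrow> config \<Rightarrow> int \<Rightarrow> int" where
  "final_height h \<eta> j = h j - int (queue \<eta> j) + int (queue \<eta> j mod 2)"

text \<open>\<open>h - queue\<close> stays constant at arrivals and at services of a nonempty queue,
  where the parity term alone moves by 1. At a hole met by an empty queue it falls by 1 and the
  parity term stays 0.\<close>

lemma is_height_final:
  assumes "queue_stable \<eta>" "is_height h \<eta>"
  shows "is_height (final_height h \<eta>) (final_config \<eta>)"
  unfolding is_height_def
proof
  fix j
  show "final_height h \<eta> j = final_height h \<eta> (j - 1) + spin (final_config \<eta>) j"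
    using queue_step[OF assms(1), of j] is_heightD[OF assms(2), of j]
    unfolding final_height_def final_config_def spin_def
    by (cases "queue \<eta> (j - 1)") (auto simp: mod2_eq_if split: if_splits)
qed

text \<open>The queue changes parity at every site except at a hole met by an empty queue, and there
  both values are 0, hence even.\<close>

lemma final_config_exclusion:
  assumes "queue_stable \<eta>"
  shows "\<not> (final_config \<eta> j \<and> final_config \<eta> (j - 1))"
  using queue_step[OF assms, of j] by (auto simp: final_config_def split: if_splits)

lemma final_height_le: "final_height h \<eta> j \<le> h j"
  by (simp add: final_height_def)

lemma final_height_antimono:
  assumes "queue_stable \<eta>" "is_height h \<eta>"
  shows "final_height h \<eta> j \<le> final_height h \<eta> (j - 2)"
  using is_heightD[OF is_height_final[OF assms], of j]
    is_heightD[OF is_height_final[OF assms], of "j - 1"] final_config_exclusion[OF assms(1), of j]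
  by (auto simp: spin_def split: if_splits)

lemma final_height_attained:
  assumes "queue_stable \<eta>" "is_height h \<eta>"
  shows "\<exists>s::nat. h (j - 2 * int s) \<le> final_height h \<eta> j"
proof -
  obtain n where n: "back_sum \<eta> j n = int (queue \<eta> j)"
    using queue_attained[OF assms(1)] by blast
  then have hn: "h j - h (j - int n) = int (queue \<eta> j)"
    using is_height_back_sum[OF assms(2)] by simp
  then have par: "even (queue \<eta> j) \<longleftrightarrow> even n"
    using is_height_parity[OF assms(2), of j n] by simp
  show ?thesis
  proof (cases "even n")
    case True
    then obtain s where "n = 2 * s" by blast
    then show ?thesis using hn by (intro exI[of _ s]) (simp add: final_height_def)
  next
    case False
    then obtain s where s: "n = 2 * s + 1" by (rule oddE)
    \<comment> \<open>The minimum lies at a site of the wrong parity. Its right neighbour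
      \<open>j - 2 * s\<close> is at most 1 higher, which is exactly the parity correction in
      \<open>final_height\<close>.\<close>
    have "h (j - 2 * int s) \<le> h (j - int n) + 1"
      using is_heightD[OF assms(2), of "j - 2 * int s"] s
      by (simp add: spin_def algebra_simps split: if_splits)
    moreover have "queue \<eta> j mod 2 = 1" using par False by (simp add: odd_iff_mod_2_eq_one)
    ultimately show ?thesis using hn by (intro exI[of _ s]) (simp add: final_height_def)
  qed
qed

subsection \<open>Height dynamics\<close>

text \<open>A leftward step raises local minima by 2, that is, \<open>h j\<close> becomes
  \<open>1 + min (h (j - 1)) (h (j + 1))\<close>. Translating by one site and dropping the constant
  1 gives this form.\<close>

definition lowerL :: "(int \<Rightarrow> int) \<Rightarrow> int \<Rightarrow> int" where
  "lowerL h j = min (h j) (h (j - 2))"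

text \<open>A facilitated jump turns \<open>110\<close> into \<open>101\<close> and so lowers the
  height at the jumping particle by 2. If site \<open>j + 1\<close> is a hole, the minimum differs
  from \<open>h j\<close> only for the pattern \<open>110\<close> around \<open>j\<close>.\<close>

definition lowerF :: "(int \<Rightarrow> int) \<Rightarrow> int \<Rightarrow> int" where
  "lowerF h j = (if h (j + 1) < h j then min (h j) (h (j - 2)) else h j)"

lemma is_height_lowerL:
  assumes "is_height h \<eta>"
  shows "is_height (lowerL h) ((translate \<circ> tasepL) \<eta>)"
  unfolding is_height_def
proof
  fix j
  show "lowerL h j = lowerL h (j - 1) + spin ((translate \<circ> tasepL) \<eta>) j"
    using is_heightD[OF assms, of j] is_heightD[OF assms, of "j - 1"] is_heightD[OF assms, of "j - 2"]
    by (auto simp: lowerL_def spin_def translate_def tasepL_def tasepL_jumps_def split: if_splits)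
qed

lemma is_height_lowerF:
  assumes "is_height h \<eta>"
  shows "is_height (lowerF h) (ftasep \<eta>)"
  unfolding is_height_def
proof
  fix j
  show "lowerF h j = lowerF h (j - 1) + spin (ftasep \<eta>) j"
    using is_heightD[OF assms, of j] is_heightD[OF assms, of "j - 1"] is_heightD[OF assms, of "j - 2"]
      is_heightD[OF assms, of "j + 1"]
    by (auto simp: lowerF_def spin_def ftasep_def ftasep_jumps_def split: if_splits)
qed

lemma is_height_funpow:
  assumes "is_height h \<eta>" "\<And>h \<eta>. is_height h \<eta> \<Longrightarrow> is_height (L h) (T \<eta>)"
  shows "is_height ((L ^^ t) h) ((T ^^ t) \<eta>)"
  by (induction t) (simp_all add: assms)

lemma is_height_inj: "is_height h \<eta> \<Longrightarrow> \<eta> j \<longleftrightarrow> h (j - 1) < h j"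
  using is_heightD[of h \<eta> j] by (simp add: spin_def split: if_splits)

text \<open>The occupation of \<open>k\<close> is read off from the heights at \<open>k - 1\<close>
  and \<open>k\<close>, so it freezes once these two do.\<close>

lemma pointwise_limit_height:
  assumes "\<And>t. is_height (g t) (\<zeta> t)" "is_height w \<xi>"
    and "\<And>j. eventually (\<lambda>t. g t j = w j) sequentially"
  shows "pointwise_limit \<zeta> \<xi>"
  unfolding pointwise_limit_def
proof
  fix k
  have "eventually (\<lambda>t. \<zeta> t k = \<xi> k) sequentially"
    using assms(3)[of k] assms(3)[of "k - 1"]
    by eventually_elim (simp add: is_height_inj[OF assms(1)] is_height_inj[OF assms(2)])
  then show "(\<lambda>t. \<zeta> t k) \<longlonglongrightarrow> \<xi> k" by (rule tendsto_eventually)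
qed

text \<open>After \<open>t\<close> steps the height at \<open>j\<close> is at most every
  \<open>h (j - 2 * s)\<close> with \<open>s \<le> t\<close>, and it never drops below
  \<open>final_height\<close>. The latter bounds some \<open>h (j - 2 * s)\<close> from above, so
  the two bounds meet after finitely many steps.\<close>

lemma pointwise_limit_tasepL:
  assumes "queue_stable \<eta>"
  shows "pointwise_limit (\<lambda>t. ((translate \<circ> tasepL) ^^ t) \<eta>) (final_config \<eta>)"
proof -
  obtain h where h: "is_height h \<eta>" using is_height_exists by blast
  define w where "w = final_height h \<eta>"
  define g where "g = (\<lambda>t. (lowerL ^^ t) h)"
  have lower: "w j \<le> g t j" for t j
  proof (induction t arbitrary: j)
    case 0
    show ?case by (simp add: g_def w_def final_height_le)
  next
    case (Suc t)
    show ?case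
      using Suc.IH[of j] Suc.IH[of "j - 2"] final_height_antimono[OF assms h, of j]
      by (simp add: g_def lowerL_def w_def)
  qed
  have upper: "s \<le> t \<Longrightarrow> g t j \<le> h (j - 2 * int s)" for t s j
  proof (induction t arbitrary: s j)
    case 0
    then show ?case by (simp add: g_def)
  next
    case (Suc t)
    show ?case
    proof (cases s)
      case 0
      then show ?thesis using Suc.IH[of 0 j] by (simp add: g_def lowerL_def)
    next
      case (Suc r)
      then show ?thesis
        using Suc.IH[of r "j - 2"] Suc.prems by (simp add: g_def lowerL_def algebra_simps)
    qed
  qed
  show ?thesis
  proof (rule pointwise_limit_height)
    show "is_height (g t) (((translate \<circ> tasepL) ^^ t) \<eta>)" for t
      unfolding g_def by (intro is_height_funpow h is_height_lowerL)
    show "is_height w (final_config \<eta>)" unfolding w_def by (rule is_height_final[OF assms h])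
    fix j
    obtain s where s: "h (j - 2 * int s) \<le> w j"
      using final_height_attained[OF assms h] unfolding w_def by blast
    show "eventually (\<lambda>t. g t j = w j) sequentially"
      using eventually_ge_at_top[of s]
      by eventually_elim (meson s lower upper order.antisym order.trans)
  qed
qed

lemma decreasing_int_eventually_const:
  fixes a :: "nat \<Rightarrow> int"
  assumes "\<And>t. a (Suc t) \<le> a t" "\<And>t. c \<le> a t"
  shows "\<exists>l. eventually (\<lambda>t. a t = l) sequentially"
proof -
  define T where "T = arg_min (\<lambda>t. nat (a t - c)) (\<lambda>_. True)"
  have T: "nat (a T - c) \<le> nat (a t - c)" for t
    unfolding T_def by (rule arg_min_nat_le) simp
  have "a t = a T" if "t \<ge> T" for t
    using lift_Suc_antimono_le[of a T t] assms T[of t] that by (smt (verit) nat_le_eq_zle nat_mono_iff)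
  then show ?thesis by (auto simp: eventually_at_top_linorder)
qed

text \<open>The heights decrease and are bounded below by \<open>w\<close>, so each freezes at some
  \<open>l j\<close>, and \<open>l\<close> is a fixed point of \<open>lowerF\<close>. The hypothesis
  \<open>right\<close> is the drift that excludes an infinite run of particles in
  \<open>l\<close>.\<close>

lemma pointwise_limit_ftasep:
  assumes "queue_stable \<eta>" and right: "\<And>C. \<exists>n. C \<le> int n \<and> back_sum \<eta> (int n) n < int n - C"
  shows "pointwise_limit (\<lambda>t. (ftasep ^^ t) \<eta>) (final_config \<eta>)"
proof -
  obtain h where h: "is_height h \<eta>" using is_height_exists by blast
  define w where "w = final_height h \<eta>"
  define g where "g = (\<lambda>t. (lowerF ^^ t) h)"
  have lower: "w j \<le> g t j" for t j
  proof (induction t arbitrary: j)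
    case 0
    show ?case by (simp add: g_def w_def final_height_le)
  next
    case (Suc t)
    show ?case
      using Suc.IH[of j] Suc.IH[of "j - 2"] final_height_antimono[OF assms(1) h, of j]
      by (simp add: g_def lowerF_def w_def)
  qed
  have "g (Suc t) j \<le> g t j" for t j
    by (simp add: g_def lowerF_def)
  then have "\<exists>l. eventually (\<lambda>t. g t j = l) sequentially" for j
    by (rule decreasing_int_eventually_const[OF _ lower])
  then obtain l where l: "\<And>j. eventually (\<lambda>t. g t j = l j) sequentially" by metis
  have height_g: "is_height (g t) ((ftasep ^^ t) \<eta>)" for t
    unfolding g_def by (intro is_height_funpow h is_height_lowerF)
  have l_le_h: "l j \<le> h j" for j
  proof -
    have "g t j \<le> h j" for t
      by (induction t) (auto simp: g_def lowerF_def)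
    with l[of j] show ?thesis
      by (metis (mono_tags, lifting) eventually_sequentially order_refl)
  qed
  have l_ge_w: "w j \<le> l j" for j
    using l[of j] lower by (metis (mono_tags, lifting) eventually_sequentially order_refl)
  \<comment> \<open>\<open>lowerF\<close> at \<open>j\<close> looks at three sites only, so one late
    time serves all of them.\<close>
  have l_fixed: "lowerF l j = l j" for j
  proof -
    have "eventually (\<lambda>t. g (Suc t) j = l j) sequentially"
      using l[of j] by (simp add: eventually_sequentially_Suc[of "\<lambda>t. g t j = l j"])
    with l[of j] l[of "j - 2"] l[of "j + 1"]
    have "eventually (\<lambda>t. lowerF l j = l j) sequentially"
    proof eventually_elim
      case (elim t)
      have "lowerF l j = lowerF (g t) j" unfolding lowerF_def using elim by simp
      also have "\<dots> = g (Suc t) j" by (simp add: g_def)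
      finally show ?case using elim by simp
    qed
    then show ?thesis by simp
  qed
  have l_step: "l j = l (j - 1) + 1 \<or> l j = l (j - 1) - 1" for j
  proof -
    have "eventually (\<lambda>t. l j = l (j - 1) + 1 \<or> l j = l (j - 1) - 1) sequentially"
      using l[of j] l[of "j - 1"]
    proof eventually_elim
      case (elim t)
      then show ?case using is_heightD[OF height_g, of t j] by (simp add: spin_def split: if_splits)
    qed
    then show ?thesis by simp
  qed
  text \<open>A fixed point of the facilitated dynamics has no pattern \<open>110\<close>, so two adjacent particles
    would be followed by particles only, contradicting the downward drift of \<open>h\<close>.\<close>
  have l_antimono: "l j \<le> l (j - 2)" for j
  proof (rule ccontr)
    assume "\<not> l j \<le> l (j - 2)"
    then have up: "l j = l (j - 1) + 1" "l (j - 1) = l (j - 2) + 1"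
      using l_step[of j] l_step[of "j - 1"] by auto
    \<comment> \<open>Three consecutive heights are carried along because \<open>lowerF\<close>
      compares the newest one with the one two sites to the left.\<close>
    have runs: "l (j + int n) = l j + int n \<and> l (j + int n - 1) = l j + int n - 1 \<and>
        l (j + int n - 2) = l j + int n - 2" for n
    proof (induction n)
      case 0
      then show ?case using up by simp
    next
      case (Suc n)
      then have "\<not> l (j + int n + 1) < l (j + int n)"
        using l_fixed[of "j + int n"] by (auto simp: lowerF_def split: if_splits)
      then have "l (j + int n + 1) = l (j + int n) + 1" using l_step[of "j + int n + 1"] by auto
      then show ?case using Suc by (simp add: algebra_simps)
    qed
    \<comment> \<open>The constant yields both \<open>j \<le> n\<close> and
      \<open>h n < l j + n - j = l n\<close>, against \<open>l \<le> h\<close>.\<close>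
    obtain n :: nat where n: "\<bar>j\<bar> + \<bar>h 0 - l j\<bar> \<le> int n"
        "back_sum \<eta> (int n) n < int n - (\<bar>j\<bar> + \<bar>h 0 - l j\<bar>)"
      using right by blast
    have "j \<le> int n" using n(1) by linarith
    then have "l (int n) = l j + int n - j" using runs[of "nat (int n - j)"] n(1) by simp
    moreover have "h (int n) = h 0 + back_sum \<eta> (int n) n"
      using is_height_back_sum[OF h, of "int n" n] by simp
    ultimately show False using l_le_h[of "int n"] n(2) by linarith
  qed
  have l_eq_w: "l j = w j" for j
  proof -
    obtain s where s: "h (j - 2 * int s) \<le> w j"
      using final_height_attained[OF assms(1) h] unfolding w_def by blast
    \<comment> \<open>This closes the chain \<open>w j \<le> l j \<le> l (j - 2 * s) \<le> h (j - 2
      * s) \<le> w j\<close>.\<close>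
    have "l j \<le> l (j - 2 * int s)"
    proof (induction s)
      case (Suc s)
      then show ?case using l_antimono[of "j - 2 * int s"] by (simp add: algebra_simps)
    qed simp
    then show ?thesis using s l_le_h[of "j - 2 * int s"] l_ge_w[of j] by linarith
  qed
  show ?thesis
  proof (rule pointwise_limit_height)
    show "is_height w (final_config \<eta>)" unfolding w_def by (rule is_height_final[OF assms(1) h])
  qed (use height_g l l_eq_w in auto)
qed

section \<open>Consequences of a density below one half\<close>

lemma back_sum_eq_sum: "back_sum \<eta> j n = (\<Sum>i\<in>{j - int n + 1..j}. spin \<eta> i)"
  unfolding back_sum_def
  by (rule sum.reindex_bij_witness[of _ "\<lambda>i. nat (j - i)" "\<lambda>i. j - int i"]) auto

lemma back_sum_eq_count:
  "real_of_int (back_sum \<eta> j n) = 2 * (\<Sum>i\<in>{j - int n + 1..j}. of_bool (\<eta> i)) - real n"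
proof -
  have "real_of_int (back_sum \<eta> j n) = (\<Sum>i\<in>{j - int n + 1..j}. 2 * of_bool (\<eta> i) - 1)"
    unfolding back_sum_eq_sum of_int_sum by (rule sum.cong) (auto simp: spin_def)
  then show ?thesis by (simp add: sum_subtractf sum_distrib_left)
qed

lemma back_sum_le: "back_sum \<eta> j n \<le> int n"
  unfolding back_sum_def
  by (rule order_trans[OF sum_mono[of _ _ "\<lambda>_. 1"]]) (auto simp: spin_def)

text \<open>Left density below 1/2 makes all long sums ending at -1 negative, and the finitely many
  short ones are bounded by their length. The end point -1 matches the window
  \<open>{- N..-1}\<close>.\<close>

lemma density_imp_stable:
  assumes "\<eta> \<in> density_configs \<rho>" "\<rho> < 1 / 2"
  shows "queue_stable \<eta>"
proof -
  have "(\<lambda>N::nat. (\<Sum>i\<in>{- int N..-1}. of_bool (\<eta> i)) / real N) \<longlonglongrightarrow> \<rho>"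
    using assms(1) by (simp add: density_configs_def)
  from order_tendstoD(2)[OF this assms(2)] eventually_gt_at_top[of 0]
  have "eventually (\<lambda>n. back_sum \<eta> (-1) n \<le> 0) sequentially"
  proof eventually_elim
    case (elim n)
    then have "real_of_int (back_sum \<eta> (-1) n) < 0"
      unfolding back_sum_eq_count by (simp add: field_simps)
    then show ?case by linarith
  qed
  then obtain N where N: "\<And>n. n \<ge> N \<Longrightarrow> back_sum \<eta> (-1) n \<le> 0"
    by (auto simp: eventually_at_top_linorder)
  have "back_sum \<eta> (-1) n \<le> int N" for n
    using N[of n] back_sum_le[of \<eta> "-1" n] by (cases "n \<ge> N") auto
  then show ?thesis by (rule queue_stableI)
qed

lemma density_imp_right_drift:
  assumes "\<eta> \<in> density_configs \<rho>" "\<rho> < 1 / 2"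
  shows "\<exists>n. C \<le> int n \<and> back_sum \<eta> (int n) n < int n - C"
proof -
  have "(\<lambda>N::nat. (\<Sum>i\<in>{1..int N}. of_bool (\<eta> i)) / real N) \<longlonglongrightarrow> \<rho>"
    using assms(1) by (simp add: density_configs_def)
  from order_tendstoD(2)[OF this assms(2)] eventually_gt_at_top[of "nat \<bar>C\<bar>"]
  have "eventually (\<lambda>n. C \<le> int n \<and> back_sum \<eta> (int n) n < int n - C) sequentially"
  proof eventually_elim
    case (elim n)
    then have "real_of_int (back_sum \<eta> (int n) n) < 0"
      unfolding back_sum_eq_count by (simp add: field_simps)
    then show ?case using elim(2) by linarith
  qed
  then show ?thesis by (rule eventually_happens'[OF sequentially_bot])
qed

lemma pointwise_limit_ftasep_density:
  assumes "\<eta> \<in> density_configs \<rho>" "\<rho> < 1 / 2"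
  shows "pointwise_limit (\<lambda>t. (ftasep ^^ t) \<eta>) (final_config \<eta>)"
  using pointwise_limit_ftasep[OF density_imp_stable[OF assms] density_imp_right_drift[OF assms]] .

subsection \<open>Measurability and weak limits\<close>

text \<open>Second countability is what identifies the Borel sets of the countable product with the
  product sigma-algebra.\<close>

instance bool :: second_countable_topology
proof
  show "\<exists>B::bool set set. countable B \<and> open = generate_topology B"
    by (intro exI[of _ "range lessThan \<union> range greaterThan"]) (auto simp: open_bool_def)
qed

lemma sets_borel_bool: "sets (borel :: bool measure) = sets (count_space UNIV)"
  by (auto intro: borel_open discrete_topology_class.open_discrete)

lemma sets_borel_config: "sets (borel :: config measure) = sets (\<Pi>\<^sub>M k\<in>UNIV. count_space UNIV)"
  unfolding sets_PiM_equal_borel[symmetric]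
  by (rule sets_PiM_cong) (simp_all add: sets_borel_bool)

lemma measurable_component_config [measurable]: "Measurable.pred borel (\<lambda>\<eta>::config. \<eta> k)"
proof -
  have "(\<lambda>\<eta>::config. \<eta> k) \<in> measurable (\<Pi>\<^sub>M k\<in>UNIV. count_space UNIV) (count_space UNIV)"
    by measurable
  then show ?thesis
    by (simp add: measurable_cong_sets[OF sets_borel_config refl])
qed

lemma measurable_configI:
  assumes "\<And>k. Measurable.pred M (\<lambda>x. f x k)"
  shows "(f :: _ \<Rightarrow> config) \<in> borel_measurable M"
proof -
  have "f \<in> measurable M (\<Pi>\<^sub>M k\<in>UNIV. count_space UNIV)"
    by (rule measurable_PiM_single') (use assms in auto)
  then show ?thesis
    by (simp add: measurable_cong_sets[OF refl sets_borel_config])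
qed

lemma measurable_ftasep [measurable]: "ftasep \<in> borel_measurable borel"
  by (rule measurable_configI) (simp add: ftasep_def ftasep_jumps_def)

lemma measurable_tasepL [measurable]: "tasepL \<in> borel_measurable borel"
  by (rule measurable_configI) (simp add: tasepL_def tasepL_jumps_def)

lemma measurable_tasepR [measurable]: "tasepR \<in> borel_measurable borel"
  by (rule measurable_configI) (simp add: tasepR_def tasepR_jumps_def)

lemma measurable_translate [measurable]: "translate \<in> borel_measurable borel"
  by (rule measurable_configI) (simp add: translate_def)

lemma measurable_reflect [measurable]: "reflect \<in> borel_measurable borel"
  by (rule measurable_configI) (simp add: reflect_def)

lemma measurable_exchange [measurable]: "exchange \<in> borel_measurable borel"
  by (rule measurable_configI) (simp add: exchange_def)

lemma measurable_funpow_config [measurable (raw)]: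
  "(T :: config \<Rightarrow> config) \<in> borel_measurable borel \<Longrightarrow> T ^^ t \<in> borel_measurable borel"
  by (induction t) (auto intro: measurable_comp)

lemma measurable_back_sum_le [measurable]: "Measurable.pred borel (\<lambda>\<eta>. back_sum \<eta> j n \<le> c)"
proof (induction n arbitrary: j c)
  case (Suc n)
  have "(\<lambda>\<eta>. back_sum \<eta> j (Suc n) \<le> c) =
      (\<lambda>\<eta>. if \<eta> j then back_sum \<eta> (j - 1) n \<le> c - 1 else back_sum \<eta> (j - 1) n \<le> c + 1)"
    by (auto simp: fun_eq_iff back_sum_Suc spin_def)
  then show ?case using Suc.IH[measurable] by simp
qed simp

lemma measurable_queue [measurable]: "(\<lambda>\<eta>. queue \<eta> j) \<in> measurable borel (count_space UNIV)"
  unfolding queue_def by measurable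

lemma measurable_final_config [measurable]: "final_config \<in> borel_measurable borel"
  by (rule measurable_configI) (simp add: final_config_def)

lemma pointwise_limit_iff_tendsto: "pointwise_limit \<zeta> \<eta> \<longleftrightarrow> \<zeta> \<longlonglongrightarrow> \<eta>"
proof -
  have "\<zeta> \<longlonglongrightarrow> \<eta> \<longleftrightarrow> limitin (product_topology (\<lambda>_. euclidean) UNIV) \<zeta> \<eta> sequentially"
    by (simp add: euclidean_product_topology)
  then show ?thesis unfolding limitin_componentwise by (simp add: pointwise_limit_def)
qed

lemma config_prob_push:
  assumes "config_prob \<nu>" "f \<in> borel_measurable borel"
  shows "config_prob (push f \<nu>)"
proof -
  interpret prob_space \<nu> using assms(1) by (simp add: config_prob_def)
  have "f \<in> measurable \<nu> borel"
    using assms by (simp add: config_prob_def measurable_cong_sets[of \<nu> borel])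
  then show ?thesis by (simp add: config_prob_def push_def prob_space_distr)
qed

lemma push_push:
  assumes "sets \<nu> = sets borel" "f \<in> borel_measurable borel" "g \<in> borel_measurable borel"
  shows "push f (push g \<nu>) = push (f \<circ> g) \<nu>"
  unfolding push_def
  by (rule distr_distr) (use assms in \<open>simp_all add: measurable_cong_sets[of \<nu> borel]\<close>)

lemma push_id: "sets \<nu> = sets borel \<Longrightarrow> push (\<lambda>x. x) \<nu> = \<nu>"
  unfolding push_def by (rule distr_id2) simp

lemma sets_push [simp]: "sets (push f \<nu>) = sets borel"
  by (simp add: push_def)

text \<open>Dominated convergence: a continuous test function preserves the almost sure limit, and
  its bound is an integrable majorant.\<close>

lemma weak_limit_pushI:
  assumes \<nu>: "config_prob \<nu>"
    and meas: "\<And>t. g t \<in> borel_measurable borel" "G \<in> borel_measurable borel"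
    and lim: "AE \<eta> in \<nu>. pointwise_limit (\<lambda>t. g t \<eta>) (G \<eta>)"
  shows "weak_limit (\<lambda>t. push (g t) \<nu>) (push G \<nu>)"
  unfolding weak_limit_def
proof (intro conjI allI impI)
  fix f :: "config \<Rightarrow> real"
  assume f: "continuous_on UNIV f" "bounded (range f)"
  interpret prob_space \<nu> using \<nu> by (simp add: config_prob_def)
  have sets: "sets \<nu> = sets borel" using \<nu> by (simp add: config_prob_def)
  have meas': "g t \<in> borel_measurable \<nu>" "G \<in> borel_measurable \<nu>" for t
    using meas by (simp_all add: measurable_cong_sets[OF sets refl])
  have fm: "f \<in> borel_measurable borel" using f(1) by (rule borel_measurable_continuous_onI)
  obtain B where B: "\<And>x. norm (f x) \<le> B" using f(2) by (auto simp: bounded_iff)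
  have "(\<lambda>t. integral\<^sup>L \<nu> (\<lambda>\<eta>. f (g t \<eta>))) \<longlonglongrightarrow> integral\<^sup>L \<nu> (\<lambda>\<eta>. f (G \<eta>))"
  proof (rule integral_dominated_convergence[where w = "\<lambda>_. B"])
    show "AE \<eta> in \<nu>. (\<lambda>t. f (g t \<eta>)) \<longlonglongrightarrow> f (G \<eta>)"
      using lim
    proof eventually_elim
      case (elim \<eta>)
      then show ?case
        using continuous_on_tendsto_compose[OF f(1)] by (simp add: pointwise_limit_iff_tendsto)
    qed
  qed (use B fm meas' in \<open>auto intro: measurable_compose\<close>)
  then show "(\<lambda>t. integral\<^sup>L (push (g t) \<nu>) f) \<longlonglongrightarrow> integral\<^sup>L (push G \<nu>) f"
    unfolding push_def using fm meas' by (simp add: integral_distr)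
qed (use \<nu> meas in \<open>auto intro: config_prob_push\<close>)

text \<open>Composing a bounded continuous test function with \<open>r\<close> gives another
  one.\<close>

lemma weak_limit_push_continuous:
  assumes "weak_limit M L" "continuous_on UNIV r"
  shows "weak_limit (\<lambda>t. push r (M t)) (push r L)"
  unfolding weak_limit_def
proof (intro conjI allI impI)
  have r: "r \<in> borel_measurable borel"
    using assms(2) by (rule borel_measurable_continuous_onI)
  have prob: "config_prob (M t)" "config_prob L" for t
    using assms(1) by (auto simp: weak_limit_def)
  show "config_prob (push r (M t))" "config_prob (push r L)" for t
    using prob r by (auto intro: config_prob_push)
  fix f :: "config \<Rightarrow> real"
  assume f: "continuous_on UNIV f" "bounded (range f)"
  have "continuous_on UNIV (\<lambda>x. f (r x))"
    using continuous_on_compose2[OF f(1) assms(2)] by simp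
  moreover have "bounded (range (\<lambda>x. f (r x)))"
    using f(2) by (rule bounded_subset) auto
  ultimately have "(\<lambda>t. integral\<^sup>L (M t) (\<lambda>x. f (r x))) \<longlonglongrightarrow> integral\<^sup>L L (\<lambda>x. f (r x))"
    using assms(1) by (auto simp: weak_limit_def)
  moreover have "integral\<^sup>L (push r N) f = integral\<^sup>L N (\<lambda>x. f (r x))" if "config_prob N" for N
    unfolding push_def using r that borel_measurable_continuous_onI[OF f(1)]
    by (intro integral_distr) (simp_all add: config_prob_def measurable_cong_sets[of N borel])
  ultimately show "(\<lambda>t. integral\<^sup>L (push r (M t)) f) \<longlonglongrightarrow> integral\<^sup>L (push r L) f"
    using prob by simp
qed

lemma continuous_reflect: "continuous_on UNIV reflect"
  unfolding reflect_def
  by (intro continuous_on_coordinatewise_then_product continuous_on_product_coordinates)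

lemma continuous_exchange: "continuous_on UNIV exchange"
proof -
  have "continuous_on UNIV (\<lambda>\<eta>::config. Not (\<eta> k))" for k
    by (rule continuous_on_compose2[OF _ continuous_on_product_coordinates[of k], of UNIV])
       (auto simp: continuous_on_discrete)
  then show ?thesis
    unfolding exchange_def by (intro continuous_on_coordinatewise_then_product)
qed

subsection \<open>Symmetries of the dynamics\<close>

lemma reflect_reflect [simp]: "reflect (reflect \<eta>) = \<eta>"
  by (simp add: reflect_def)

lemma tasepL_translate: "tasepL (translate \<eta>) = translate (tasepL \<eta>)"
  by (auto simp: fun_eq_iff tasepL_def tasepL_jumps_def translate_def)

lemma tasepR_reflect: "tasepR (reflect \<eta>) = reflect (tasepL \<eta>)"
  by (auto simp: fun_eq_iff tasepL_def tasepL_jumps_def tasepR_def tasepR_jumps_def reflect_def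
      algebra_simps)

text \<open>When a particle jumps one way, the hole it displaces jumps the other way, so the
  exchange swaps the two directions.\<close>

lemma tasepL_exchange: "tasepL (exchange \<eta>) = exchange (tasepR \<eta>)"
  by (auto simp: fun_eq_iff tasepL_def tasepL_jumps_def tasepR_def tasepR_jumps_def exchange_def)

lemma tasepR_exchange: "tasepR (exchange \<eta>) = exchange (tasepL \<eta>)"
  by (auto simp: fun_eq_iff tasepL_def tasepL_jumps_def tasepR_def tasepR_jumps_def exchange_def)

lemma funpow_intertwine:
  assumes "\<And>x. T (r x) = r (S x)"
  shows "(T ^^ t) (r x) = r ((S ^^ t) x)"
  by (induction t) (simp_all add: assms)

text \<open>Collects all translations at the initial configuration, where an invariant measure
  absorbs them.\<close>

lemma translate_tasepL_funpow: "((translate \<circ> tasepL) ^^ t) \<eta> = (tasepL ^^ t) ((translate ^^ t) \<eta>)"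
proof (induction t)
  case (Suc t)
  have "(tasepL ^^ t) (translate \<xi>) = translate ((tasepL ^^ t) \<xi>)" for \<xi>
    by (rule funpow_intertwine[of tasepL translate tasepL, OF tasepL_translate])
  with Suc show ?case by (simp add: tasepL_translate)
qed simp

lemma push_translate_funpow:
  assumes "translation_invariant \<nu>" "sets \<nu> = sets borel"
  shows "push (translate ^^ t) \<nu> = \<nu>"
proof (induction t)
  case 0
  then show ?case using push_id[OF assms(2)] by (simp add: id_def)
next
  case (Suc t)
  have "push (translate ^^ Suc t) \<nu> = push translate (push (translate ^^ t) \<nu>)"
    using assms(2) by (subst push_push) (auto intro: measurable_funpow_config)
  with Suc assms(1) show ?case by (simp only: translation_invariant_def)
qed

lemma translation_invariant_reflect:
  assumes "translation_invariant \<nu>" "sets \<nu> = sets borel"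
  shows "translation_invariant (push reflect \<nu>)"
proof -
  \<comment> \<open>Invariance of \<open>\<nu>\<close> inserts a second translation, which the
    reflection turns into the inverse of the first.\<close>
  have "push translate (push reflect \<nu>) = push (translate \<circ> reflect) (push translate \<nu>)"
    using assms by (simp add: push_push translation_invariant_def)
  also have "\<dots> = push (translate \<circ> reflect \<circ> translate) \<nu>"
    using assms(2) by (subst push_push) (auto intro: measurable_comp)
  also have "translate \<circ> reflect \<circ> translate = reflect"
    by (auto simp: fun_eq_iff translate_def reflect_def)
  finally show ?thesis by (simp add: translation_invariant_def)
qed

lemma reflect_density_configs: "reflect \<eta> \<in> density_configs \<rho> \<longleftrightarrow> \<eta> \<in> density_configs \<rho>"
proof -
  have "(\<Sum>i\<in>{1..int N}. of_bool (\<eta> (- i)) :: real) = (\<Sum>i\<in>{- int N..-1}. of_bool (\<eta> i))"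
    "(\<Sum>i\<in>{- int N..-1}. of_bool (\<eta> (- i)) :: real) = (\<Sum>i\<in>{1..int N}. of_bool (\<eta> i))" for N
    by (rule sum.reindex_bij_witness[of _ uminus uminus]; auto)+
  then show ?thesis by (auto simp: density_configs_def reflect_def)
qed

section \<open>Weak limits for invariant initial measures\<close>

lemma weak_limit_ftasep:
  assumes "config_prob \<nu>" "AE \<eta> in \<nu>. \<eta> \<in> density_configs \<rho>" "\<rho> < 1 / 2"
  shows "weak_limit (\<lambda>t. push (ftasep ^^ t) \<nu>) (push final_config \<nu>)"
proof (rule weak_limit_pushI[OF assms(1)])
  show "AE \<eta> in \<nu>. pointwise_limit (\<lambda>t. (ftasep ^^ t) \<eta>) (final_config \<eta>)"
    using assms(2) by eventually_elim (rule pointwise_limit_ftasep_density[OF _ assms(3)])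
qed (auto intro: measurable_funpow_config)

text \<open>Only the translated evolution converges pointwise; under an invariant measure it has the
  same law at each time as the evolution without translations.\<close>

lemma weak_limit_tasepL:
  assumes "config_prob \<nu>" "translation_invariant \<nu>" "AE \<eta> in \<nu>. \<eta> \<in> density_configs \<rho>" "\<rho> < 1 / 2"
  shows "weak_limit (\<lambda>t. push (tasepL ^^ t) \<nu>) (push final_config \<nu>)"
proof -
  have sets: "sets \<nu> = sets borel" using assms(1) by (simp add: config_prob_def)
  have "weak_limit (\<lambda>t. push ((translate \<circ> tasepL) ^^ t) \<nu>) (push final_config \<nu>)"
  proof (rule weak_limit_pushI[OF assms(1)])
    show "AE \<eta> in \<nu>. pointwise_limit (\<lambda>t. ((translate \<circ> tasepL) ^^ t) \<eta>) (final_config \<eta>)"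
      using assms(3) by eventually_elim (rule pointwise_limit_tasepL[OF density_imp_stable[OF _ assms(4)]])
  qed (auto intro!: measurable_funpow_config measurable_comp[of _ borel borel])
  moreover have "push ((translate \<circ> tasepL) ^^ t) \<nu> = push (tasepL ^^ t) \<nu>" for t
  proof -
    have "(translate \<circ> tasepL) ^^ t = (tasepL ^^ t) \<circ> (translate ^^ t)"
      by (simp add: fun_eq_iff translate_tasepL_funpow)
    then have "push ((translate \<circ> tasepL) ^^ t) \<nu> = push (tasepL ^^ t) (push (translate ^^ t) \<nu>)"
      using sets by (simp add: push_push measurable_funpow_config)
    then show ?thesis by (simp add: push_translate_funpow[OF assms(2) sets])
  qed
  ultimately show ?thesis by simp
qed

lemma push_tasepR:
  assumes "sets \<nu> = sets borel"
  shows "push (tasepR ^^ t) \<nu> = push reflect (push (tasepL ^^ t) (push reflect \<nu>))"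
proof -
  have "push reflect (push (tasepL ^^ t) (push reflect \<nu>)) = push (reflect \<circ> (tasepL ^^ t) \<circ> reflect) \<nu>"
    using assms by (simp add: push_push measurable_funpow_config measurable_comp[of _ borel borel] comp_assoc)
  also have "reflect \<circ> (tasepL ^^ t) \<circ> reflect = tasepR ^^ t"
    by (simp add: fun_eq_iff funpow_intertwine[of tasepR reflect tasepL, OF tasepR_reflect, symmetric])
  finally show ?thesis ..
qed

lemma weak_limit_tasepR:
  assumes "config_prob \<nu>" "translation_invariant \<nu>"
    "AE \<eta> in push reflect \<nu>. \<eta> \<in> density_configs \<rho>" "\<rho> < 1 / 2"
  shows "weak_limit (\<lambda>t. push (tasepR ^^ t) \<nu>) (push reflect (push final_config (push reflect \<nu>)))"
proof -
  have sets: "sets \<nu> = sets borel" using assms(1) by (simp add: config_prob_def)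
  have "weak_limit (\<lambda>t. push (tasepL ^^ t) (push reflect \<nu>)) (push final_config (push reflect \<nu>))"
    using assms sets
    by (intro weak_limit_tasepL config_prob_push translation_invariant_reflect) auto
  from weak_limit_push_continuous[OF this continuous_reflect] show ?thesis
    by (simp add: push_tasepR[OF sets])
qed

lemma AE_density_of_measure_1:
  assumes "config_prob \<nu>" "measure \<nu> (density_configs \<rho>) = 1"
  shows "AE \<eta> in \<nu>. \<eta> \<in> density_configs \<rho>" "AE \<eta> in push reflect \<nu>. \<eta> \<in> density_configs \<rho>"
proof -
  interpret prob_space \<nu> using assms(1) by (simp add: config_prob_def)
  \<comment> \<open>A non-measurable set has measure 0 by convention, so measure 1 forces
    measurability.\<close>
  have meas: "density_configs \<rho> \<in> sets \<nu>"
    using assms(2) measure_notin_sets[of "density_configs \<rho>" \<nu>] by fastforce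
  show AE: "AE \<eta> in \<nu>. \<eta> \<in> density_configs \<rho>"
    using prob_eq_1[OF meas] assms(2) by simp
  have sets: "sets \<nu> = sets borel" using assms(1) by (simp add: config_prob_def)
  show "AE \<eta> in push reflect \<nu>. \<eta> \<in> density_configs \<rho>"
    unfolding push_def using meas AE sets
    by (subst AE_distr_iff)
       (auto simp: reflect_density_configs measurable_cong_sets[of \<nu> borel] simp del: sets_push)
qed

subsection \<open>Bernoulli measures\<close>

text \<open>Finite-dimensional cylinders generate the sigma-algebra and are closed under
  intersection.\<close>

lemma config_measure_eqI:
  assumes sets: "sets \<nu> = sets borel" "sets \<nu>' = sets borel" and "finite_measure \<nu>"
    and eq: "\<And>J A. finite J \<Longrightarrow> emeasure \<nu> {\<eta>::config. \<forall>j\<in>J. \<eta> j \<in> A j} = emeasure \<nu>' {\<eta>. \<forall>j\<in>J. \<eta> j \<in> A j}"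
  shows "\<nu> = \<nu>'"
proof (rule measure_eqI_PiM_infinite[of _ UNIV "\<lambda>_. count_space UNIV"])
  fix J :: "int set" and A :: "int \<Rightarrow> bool set"
  assume J: "finite J"
  have "prod_emb UNIV (\<lambda>_. count_space UNIV) J (Pi\<^sub>E J A) = {\<eta>. \<forall>j\<in>J. \<eta> j \<in> A j}"
    by (auto simp: prod_emb_def PiE_def Pi_def)
  then show "emeasure \<nu> (prod_emb UNIV (\<lambda>_. count_space UNIV) J (Pi\<^sub>E J A)) =
      emeasure \<nu>' (prod_emb UNIV (\<lambda>_. count_space UNIV) J (Pi\<^sub>E J A))"
    using eq[OF J] by simp
qed (use assms in \<open>simp_all add: sets_borel_config\<close>)

lemma sets_bernoulli_measure [simp, measurable_cong]: "sets (bernoulli_measure p) = sets borel"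
  unfolding bernoulli_measure_def sets_borel_config by (rule sets_PiM_cong) simp_all

lemma space_bernoulli_measure [simp]: "space (bernoulli_measure p) = UNIV"
  using sets_eq_imp_space_eq[OF sets_bernoulli_measure] by simp

lemma prob_space_bernoulli_measure: "prob_space (bernoulli_measure p)"
  unfolding bernoulli_measure_def by (rule prob_space_PiM) (rule prob_space_measure_pmf)

lemma config_prob_bernoulli_measure: "config_prob (bernoulli_measure p)"
  by (simp add: config_prob_def prob_space_bernoulli_measure)

lemma emeasure_bernoulli_cylinder:
  assumes "finite J"
  shows "emeasure (bernoulli_measure p) {\<eta>. \<forall>j\<in>J. \<eta> j \<in> A j} =
    (\<Prod>j\<in>J. emeasure (measure_pmf (bernoulli_pmf p)) (A j))"
proof -
  interpret product_prob_space "\<lambda>_::int. measure_pmf (bernoulli_pmf p)" UNIV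
    by unfold_locales
  have "prod_emb UNIV (\<lambda>_. measure_pmf (bernoulli_pmf p)) J (Pi\<^sub>E J A) = {\<eta>. \<forall>j\<in>J. \<eta> j \<in> A j}"
    by (auto simp: prod_emb_def PiE_def Pi_def)
  then show ?thesis
    using emeasure_PiM_emb[of J A] assms by (simp add: bernoulli_measure_def)
qed

lemma bernoulli_measure_eqI:
  assumes "sets \<nu> = sets borel"
    and "\<And>J A. finite J \<Longrightarrow> emeasure \<nu> {\<eta>. \<forall>j\<in>J. \<eta> j \<in> A j} =
      (\<Prod>j\<in>J. emeasure (measure_pmf (bernoulli_pmf p)) (A j))"
  shows "\<nu> = bernoulli_measure p"
proof -
  interpret prob_space "bernoulli_measure p" by (rule prob_space_bernoulli_measure)
  have "bernoulli_measure p = \<nu>"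
    by (rule config_measure_eqI)
       (use assms finite_measure_axioms in \<open>simp_all add: emeasure_bernoulli_cylinder\<close>)
  then show ?thesis ..
qed

lemma measurable_cylinder [measurable]:
  "finite J \<Longrightarrow> {\<eta>::config. \<forall>j\<in>J. \<eta> j \<in> A j} \<in> sets borel"
proof -
  assume J: "finite J"
  have "Measurable.pred borel (\<lambda>\<eta>::config. \<eta> j \<in> A j)" for j
    by measurable
  with J have "Measurable.pred borel (\<lambda>\<eta>::config. \<forall>j\<in>J. \<eta> j \<in> A j)"
    by (intro pred_intros_finite)
  then show ?thesis by (simp add: pred_def)
qed

text \<open>An injective relabelling sends cylinders to cylinders with the same factors. This covers
  reflection and all translations at once.\<close>

lemma push_reindex_bernoulli:
  assumes "inj \<pi>"
  shows "push (\<lambda>\<eta> k. \<eta> (\<pi> k)) (bernoulli_measure p) = bernoulli_measure p"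
proof (rule bernoulli_measure_eqI)
  fix J :: "int set" and A :: "int \<Rightarrow> bool set"
  assume J: "finite J"
  have inj: "inj_on \<pi> J" using assms by (rule inj_on_subset) simp
  have meas: "(\<lambda>\<eta> k. \<eta> (\<pi> k)) \<in> borel_measurable (bernoulli_measure p)"
    by (rule measurable_configI) measurable
  have "emeasure (push (\<lambda>\<eta> k. \<eta> (\<pi> k)) (bernoulli_measure p)) {\<eta>. \<forall>j\<in>J. \<eta> j \<in> A j} =
      emeasure (bernoulli_measure p) {\<eta>. \<forall>j\<in>J. \<eta> (\<pi> j) \<in> A j}"
    unfolding push_def using meas measurable_cylinder[OF J, of A]
    by (subst emeasure_distr) (auto simp: vimage_def)
  also have "{\<eta>. \<forall>j\<in>J. \<eta> (\<pi> j) \<in> A j} = {\<eta>. \<forall>i\<in>\<pi> ` J. \<eta> i \<in> A (inv \<pi> i)}"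
    using assms by auto
  also have "emeasure (bernoulli_measure p) \<dots> =
      (\<Prod>j\<in>J. emeasure (measure_pmf (bernoulli_pmf p)) (A j))"
    unfolding emeasure_bernoulli_cylinder[OF finite_imageI[OF J]] prod.reindex[OF inj]
    using assms by simp
  finally show "emeasure (push (\<lambda>\<eta> k. \<eta> (\<pi> k)) (bernoulli_measure p)) {\<eta>. \<forall>j\<in>J. \<eta> j \<in> A j} = \<dots>" .
qed simp

lemma push_reflect_bernoulli: "push reflect (bernoulli_measure p) = bernoulli_measure p"
  using push_reindex_bernoulli[of uminus p] by (simp add: reflect_def[abs_def])

lemma translation_invariant_bernoulli: "translation_invariant (bernoulli_measure p)"
  using push_reindex_bernoulli[of "\<lambda>k. k - 1" p]
  by (simp add: translation_invariant_def translate_def[abs_def] inj_def)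

lemma map_pmf_Not_bernoulli:
  assumes "0 \<le> p" "p \<le> 1"
  shows "map_pmf Not (bernoulli_pmf p) = bernoulli_pmf (1 - p)"
proof (rule pmf_eqI)
  fix b
  \<comment> \<open>The double negation presents \<open>b\<close> as the image of
    \<open>\<not> b\<close> under \<open>Not\<close>.\<close>
  have "pmf (map_pmf Not (bernoulli_pmf p)) (\<not> \<not> b) = pmf (bernoulli_pmf p) (\<not> b)"
    by (rule pmf_map_inj') (auto simp: inj_def)
  then show "pmf (map_pmf Not (bernoulli_pmf p)) b = pmf (bernoulli_pmf (1 - p)) b"
    using assms by (cases b) simp_all
qed

lemma push_exchange_bernoulli:
  assumes "0 \<le> p" "p \<le> 1"
  shows "push exchange (bernoulli_measure p) = bernoulli_measure (1 - p)"
proof (rule bernoulli_measure_eqI)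
  fix J :: "int set" and A :: "int \<Rightarrow> bool set"
  assume J: "finite J"
  have "emeasure (push exchange (bernoulli_measure p)) {\<eta>. \<forall>j\<in>J. \<eta> j \<in> A j} =
      emeasure (bernoulli_measure p) {\<eta>. \<forall>j\<in>J. \<eta> j \<in> Not -` A j}"
    unfolding push_def using measurable_cylinder[OF J, of A]
    by (subst emeasure_distr) (auto simp: vimage_def exchange_def)
  also have "\<dots> = (\<Prod>j\<in>J. emeasure (measure_pmf (bernoulli_pmf (1 - p))) (A j))"
    unfolding emeasure_bernoulli_cylinder[OF J] map_pmf_Not_bernoulli[OF assms, symmetric] by simp
  finally show "emeasure (push exchange (bernoulli_measure p)) {\<eta>. \<forall>j\<in>J. \<eta> j \<in> A j} = \<dots>" .
qed simp

lemma measurable_fun_upd_config: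
  "(\<lambda>(\<eta>, b). \<eta>(k := b) :: config) \<in>
    borel_measurable (bernoulli_measure p \<Otimes>\<^sub>M measure_pmf q)"
  (is "?f \<in> borel_measurable ?P")
proof (rule measurable_configI)
  fix i
  have "Measurable.pred ?P (\<lambda>x. if i = k then snd x else fst x i)"
    by measurable
  moreover have "(\<lambda>x. ?f x i) = (\<lambda>x. if i = k then snd x else fst x i)"
    by (auto simp: fun_eq_iff)
  ultimately show "Measurable.pred ?P (\<lambda>x. ?f x i)" by simp
qed

text \<open>Replacing one coordinate by a fresh independent copy preserves the law; independence of
  a single site is derived from this.\<close>

lemma bernoulli_resample:
  "distr (bernoulli_measure p \<Otimes>\<^sub>M measure_pmf (bernoulli_pmf p)) borel (\<lambda>(\<eta>, b). \<eta>(k := b)) =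
    bernoulli_measure p"
  (is "distr ?P borel ?f = _")
proof (rule bernoulli_measure_eqI)
  interpret prob_space "bernoulli_measure p" by (rule prob_space_bernoulli_measure)
  have meas: "?f \<in> borel_measurable ?P"
    by (rule measurable_fun_upd_config)
  fix J :: "int set" and A :: "int \<Rightarrow> bool set"
  assume J: "finite J"
  define B where "B = (if k \<in> J then A k else UNIV)"
  have "emeasure (distr ?P borel ?f) {\<eta>. \<forall>j\<in>J. \<eta> j \<in> A j} =
      emeasure ?P ({\<eta>. \<forall>j\<in>J - {k}. \<eta> j \<in> A j} \<times> B)"
  proof (subst emeasure_distr[OF meas measurable_cylinder[OF J]], rule arg_cong[of _ _ "emeasure ?P"])
    show "?f -` {\<eta>. \<forall>j\<in>J. \<eta> j \<in> A j} \<inter> space ?P = {\<eta>. \<forall>j\<in>J - {k}. \<eta> j \<in> A j} \<times> B"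
      by (auto simp: B_def space_pair_measure split: if_splits)
  qed
  also have "\<dots> = emeasure (bernoulli_measure p) {\<eta>. \<forall>j\<in>J - {k}. \<eta> j \<in> A j} *
      emeasure (measure_pmf (bernoulli_pmf p)) B"
    using J by (intro measure_pmf.emeasure_pair_measure_Times) auto
  also have "\<dots> = (\<Prod>j\<in>J. emeasure (measure_pmf (bernoulli_pmf p)) (A j))"
  proof (cases "k \<in> J")
    case True
    then show ?thesis
      using J by (simp add: emeasure_bernoulli_cylinder B_def prod.remove[of J k] mult.commute)
  next
    case False
    then show ?thesis
      using J by (simp add: emeasure_bernoulli_cylinder B_def)
  qed
  finally show "emeasure (distr ?P borel ?f) {\<eta>. \<forall>j\<in>J. \<eta> j \<in> A j} = \<dots>" .
qed simp

text \<open>Resample site \<open>k\<close>: since \<open>A\<close> ignores that site, the event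
  becomes a product set.\<close>

lemma bernoulli_site_independent:
  assumes A: "A \<in> sets borel" and indep: "\<And>\<eta> b. \<eta>(k := b) \<in> A \<longleftrightarrow> \<eta> \<in> A"
  shows "measure (bernoulli_measure p) {\<eta> \<in> A. \<eta> k = b} =
    measure (bernoulli_measure p) A * pmf (bernoulli_pmf p) b"
proof -
  interpret prob_space "bernoulli_measure p" by (rule prob_space_bernoulli_measure)
  let ?P = "bernoulli_measure p \<Otimes>\<^sub>M measure_pmf (bernoulli_pmf p)"
  let ?f = "\<lambda>(\<eta>, b). \<eta>(k := b) :: config"
  have meas: "?f \<in> borel_measurable ?P"
    by (rule measurable_fun_upd_config)
  have S: "{\<eta> \<in> A. \<eta> k = b} \<in> sets borel" using A by measurable
  have "emeasure (bernoulli_measure p) {\<eta> \<in> A. \<eta> k = b} = emeasure (distr ?P borel ?f) {\<eta> \<in> A. \<eta> k = b}"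
    by (simp only: bernoulli_resample)
  also have "\<dots> = emeasure ?P (A \<times> {b})"
  proof (subst emeasure_distr[OF meas S], rule arg_cong[of _ _ "emeasure ?P"])
    show "?f -` {\<eta> \<in> A. \<eta> k = b} \<inter> space ?P = A \<times> {b}"
      by (auto simp: space_pair_measure indep)
  qed
  also have "\<dots> = emeasure (bernoulli_measure p) A * emeasure (measure_pmf (bernoulli_pmf p)) {b}"
    using A by (intro measure_pmf.emeasure_pair_measure_Times) auto
  finally show ?thesis
    by (simp add: emeasure_eq_measure emeasure_pmf_single ennreal_mult' [symmetric])
qed

subsection \<open>The strong law of large numbers\<close>

lemma indep_vars_bernoulli:
  "prob_space.indep_vars (bernoulli_measure p) (\<lambda>_. borel) (\<lambda>i \<eta>. of_bool (\<eta> i) :: real) I"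
proof -
  interpret prob_space "bernoulli_measure p" by (rule prob_space_bernoulli_measure)
  have comp: "distr (bernoulli_measure p) (measure_pmf (bernoulli_pmf p)) (\<lambda>\<eta>. \<eta> i) =
      measure_pmf (bernoulli_pmf p)" for i
    unfolding bernoulli_measure_def by (rule distr_PiM_component) (auto intro: prob_space_measure_pmf)
  have "indep_vars (\<lambda>_. measure_pmf (bernoulli_pmf p)) (\<lambda>i \<eta>. \<eta> i) UNIV"
  proof (subst indep_vars_iff_distr_eq_PiM)
    show "distr (bernoulli_measure p) (\<Pi>\<^sub>M i\<in>UNIV. measure_pmf (bernoulli_pmf p)) (\<lambda>x. \<lambda>i\<in>UNIV. x i) =
        (\<Pi>\<^sub>M i\<in>UNIV. distr (bernoulli_measure p) (measure_pmf (bernoulli_pmf p)) (\<lambda>\<eta>. \<eta> i))"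
      unfolding comp by (simp add: bernoulli_measure_def[symmetric] restrict_UNIV)
  qed simp_all
  then have "indep_vars (\<lambda>_. measure_pmf (bernoulli_pmf p)) (\<lambda>i \<eta>. \<eta> i) I"
    by (rule indep_vars_subset) simp
  then show ?thesis
    by (rule indep_vars_compose2[where Y = "\<lambda>_. of_bool"]) simp
qed

lemma prob_bernoulli_site:
  assumes "0 \<le> p" "p \<le> 1"
  shows "measure (bernoulli_measure p) {\<eta>. \<eta> i} = p"
  using bernoulli_site_independent[of UNIV i p True] assms prob_space.prob_space[OF prob_space_bernoulli_measure[of p]]
  by simp

text \<open>Hoeffding's inequality makes deviations of relative size \<open>\<epsilon>\<close>
  geometrically unlikely, and Borel-Cantelli applies. The index sets are general so that both
  half-lines are covered.\<close>

lemma bernoulli_strong_law: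
  assumes p: "0 \<le> p" "p \<le> 1" and I: "\<And>N. finite (I N)" "\<And>N. card (I N) = N"
  shows "AE \<eta> in bernoulli_measure p. (\<lambda>N. (\<Sum>i\<in>I N. of_bool (\<eta> i)) / real N) \<longlonglongrightarrow> p"
proof -
  interpret prob_space "bernoulli_measure p" by (rule prob_space_bernoulli_measure)
  define A where "A = (\<lambda>\<epsilon> N. {\<eta>. \<epsilon> * real N \<le> \<bar>(\<Sum>i\<in>I N. of_bool (\<eta> i)) - real N * p\<bar>})"
  have meas: "A \<epsilon> N \<in> sets (bernoulli_measure p)" for \<epsilon> N
    unfolding A_def by simp
  have bound: "prob (A \<epsilon> N) \<le> 2 * exp (- 2 * \<epsilon>\<^sup>2) ^ N" if "\<epsilon> > 0" for \<epsilon> N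
  proof (cases "N = 0")
    case True
    then show ?thesis by (simp add: order_trans[OF prob_le_1])
  next
    case False
    interpret H: Hoeffding_ineq "bernoulli_measure p" "I N" "\<lambda>i \<eta>. of_bool (\<eta> i)" "\<lambda>_. 0" "\<lambda>_. 1"
        "\<Sum>i\<in>I N. expectation (\<lambda>\<eta>. of_bool (\<eta> i))"
      by unfold_locales (use I indep_vars_bernoulli in \<open>auto simp: of_bool_def\<close>)
    have "expectation (\<lambda>\<eta>. of_bool (\<eta> i)) = p" for i
    proof -
      have "(\<lambda>\<eta>::config. of_bool (\<eta> i) :: real) = indicator {\<eta>. \<eta> i}"
        by (auto simp: fun_eq_iff)
      then show ?thesis using prob_bernoulli_site[OF p, of i] by simp
    qed
    then have "(\<Sum>i\<in>I N. expectation (\<lambda>\<eta>. of_bool (\<eta> i))) = real N * p"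
      using I by simp
    then have "prob (A \<epsilon> N) \<le> 2 * exp (- 2 * (\<epsilon> * real N)\<^sup>2 / (\<Sum>i\<in>I N. (1 - 0)\<^sup>2))"
      using H.Hoeffding_ineq_abs_ge[of "\<epsilon> * real N"] that False I by (simp add: A_def)
    also have "- 2 * (\<epsilon> * real N)\<^sup>2 / (\<Sum>i\<in>I N. (1 - 0)\<^sup>2) = real N * (- 2 * \<epsilon>\<^sup>2)"
      using False I by (simp add: power2_eq_square)
    finally show ?thesis by (simp only: exp_of_nat_mult)
  qed
  have AE: "AE \<eta> in bernoulli_measure p. eventually (\<lambda>N. \<eta> \<notin> A \<epsilon> N) sequentially" if "\<epsilon> > 0" for \<epsilon>
  proof -
    have "summable (\<lambda>N. 2 * exp (- 2 * \<epsilon>\<^sup>2) ^ N)"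
      using that by (intro summable_mult summable_geometric) simp
    then have "summable (\<lambda>N. prob (A \<epsilon> N))"
      by (rule summable_comparison_test') (use bound[OF that] in simp)
    then have "AE \<eta> in bernoulli_measure p. eventually (\<lambda>N. \<eta> \<in> space (bernoulli_measure p) - A \<epsilon> N) sequentially"
      by (intro borel_cantelli_AE1 meas) (auto simp: less_top[symmetric])
    then show ?thesis by simp
  qed
  \<comment> \<open>Countably many tolerances suffice, so the exceptional null sets can be
    united.\<close>
  have "AE \<eta> in bernoulli_measure p. \<forall>m. eventually (\<lambda>N. \<eta> \<notin> A (1 / real (Suc m)) N) sequentially"
    unfolding AE_all_countable using AE by simp
  then show ?thesis
  proof eventually_elim
    case (elim \<eta>)
    show ?case
    proof (rule tendstoI)
      fix e :: real assume "e > 0"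
      then obtain m where m: "1 / real (Suc m) < e"
        using nat_approx_posE by metis
      from elim[rule_format, of m] eventually_gt_at_top[of 0]
      show "eventually (\<lambda>N. dist ((\<Sum>i\<in>I N. of_bool (\<eta> i)) / real N) p < e) sequentially"
      proof eventually_elim
        case (elim N)
        have "(\<Sum>i\<in>I N. of_bool (\<eta> i)) / real N - p = ((\<Sum>i\<in>I N. of_bool (\<eta> i)) - real N * p) / real N"
          using elim(2) by (simp add: diff_divide_distrib)
        then have "dist ((\<Sum>i\<in>I N. of_bool (\<eta> i)) / real N) p =
            \<bar>(\<Sum>i\<in>I N. of_bool (\<eta> i)) - real N * p\<bar> / real N"
          by (simp only: dist_real_def abs_divide abs_of_nat)
        also have "\<dots> < 1 / real (Suc m)"
          using elim by (simp add: A_def not_le pos_divide_less_eq)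
        finally show ?case using m by simp
      qed
    qed
  qed
qed

lemma AE_bernoulli_density:
  assumes "0 \<le> p" "p \<le> 1"
  shows "AE \<eta> in bernoulli_measure p. \<eta> \<in> density_configs p"
  using bernoulli_strong_law[OF assms, of "\<lambda>N. {1..int N}"]
    bernoulli_strong_law[OF assms, of "\<lambda>N. {- int N..-1}"]
  unfolding density_configs_def by simp

subsection \<open>Reversibility of the queue\<close>

text \<open>Lists of naturals form a countable type, so laws of paths can be compared on
  singletons.\<close>

definition queue_path :: "config \<Rightarrow> int \<Rightarrow> nat \<Rightarrow> nat list" where
  "queue_path \<eta> j n = map (\<lambda>i. queue \<eta> (j + int i)) [0..<n]"

definition queue_prob :: "real \<Rightarrow> nat \<Rightarrow> real" where
  "queue_prob p q = measure (bernoulli_measure p) {\<eta>. queue \<eta> 0 = q}"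

text \<open>Truncated subtraction is intended: from an empty queue a hole leads back to an empty queue.\<close>
definition trans_prob :: "real \<Rightarrow> nat \<Rightarrow> nat \<Rightarrow> real" where
  "trans_prob p a b = (if b = a + 1 then p else if b = a - 1 then 1 - p else 0)"

fun path_weight :: "real \<Rightarrow> nat list \<Rightarrow> real" where
  "path_weight p (a # b # w) = trans_prob p a b * path_weight p (b # w)"
| "path_weight p w = 1"

lemma path_weight_snoc:
  "path_weight p (w @ [a, b]) = path_weight p (w @ [a]) * trans_prob p a b"
proof (induction w)
  case (Cons c w)
  then show ?case by (cases w) simp_all
qed simp

lemma measurable_queue_path [measurable]: "(\<lambda>\<eta>. queue_path \<eta> j n) \<in> measurable borel (count_space UNIV)"
proof (induction n)
  case (Suc n)
  have "(\<lambda>\<eta>. queue_path \<eta> j (Suc n)) = (\<lambda>\<eta>. queue_path \<eta> j n @ [queue \<eta> (j + int n)])"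
    by (simp add: queue_path_def)
  then show ?case using Suc[measurable] by simp
qed (simp add: queue_path_def)

text \<open>The queue at \<open>i\<close> looks only at sites up to \<open>i\<close>; this is the
  source of the Markov property.\<close>

lemma queue_fun_upd: "i < k \<Longrightarrow> queue (\<eta>(k := b)) i = queue \<eta> i"
proof -
  assume "i < k"
  then have "back_sum (\<eta>(k := b)) i n = back_sum \<eta> i n" for n
    unfolding back_sum_def by (intro sum.cong) (auto simp: spin_def)
  then show ?thesis by (simp add: queue_def)
qed

lemma queue_prob_shift:
  "measure (bernoulli_measure p) {\<eta>. queue \<eta> j = q} = queue_prob p q"
proof -
  have "queue (\<lambda>k. \<eta> (k - j)) j = queue \<eta> 0" for \<eta>
    by (simp add: queue_def back_sum_def spin_def)
  moreover have "(\<lambda>\<eta> k. \<eta> (k - j)) \<in> borel_measurable (bernoulli_measure p)"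
    by (rule measurable_configI) measurable
  moreover have "push (\<lambda>\<eta> k. \<eta> (k - j)) (bernoulli_measure p) = bernoulli_measure p"
    by (rule push_reindex_bernoulli) (simp add: inj_def)
  ultimately show ?thesis
    unfolding queue_prob_def push_def
    using measure_distr[of "\<lambda>\<eta> k. \<eta> (k - j)" "bernoulli_measure p" borel "{\<eta>. queue \<eta> j = q}"]
    by (simp add: vimage_def)
qed

lemma AE_bernoulli_stable:
  assumes "0 \<le> p" "p < 1 / 2"
  shows "AE \<eta> in bernoulli_measure p. queue_stable \<eta>"
proof -
  have "AE \<eta> in bernoulli_measure p. \<eta> \<in> density_configs p"
    using assms by (intro AE_bernoulli_density) auto
  then show ?thesis
    by eventually_elim (rule density_imp_stable[OF _ assms(2)])
qed

text \<open>The Markov property: \<open>A\<close> stands for a past that ignores site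
  \<open>k\<close> and ends with queue length \<open>a\<close>, and Lindley's recursion makes the
  next value a function of \<open>a\<close> and an independent coin.\<close>

lemma queue_step_prob:
  assumes p: "0 \<le> p" "p < 1 / 2" and A: "A \<in> sets borel"
    and indep: "\<And>\<eta> b. \<eta>(k := b) \<in> A \<longleftrightarrow> \<eta> \<in> A" and a: "\<And>\<eta>. \<eta> \<in> A \<Longrightarrow> queue \<eta> (k - 1) = a"
  shows "measure (bernoulli_measure p) {\<eta> \<in> A. queue \<eta> k = b} =
    measure (bernoulli_measure p) A * trans_prob p a b"
proof -
  interpret prob_space "bernoulli_measure p" by (rule prob_space_bernoulli_measure)
  have step: "AE \<eta> in bernoulli_measure p. \<eta> \<in> A \<longrightarrow> queue \<eta> k = (if \<eta> k then a + 1 else a - 1)"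
    using AE_bernoulli_stable[OF p] by eventually_elim (metis a queue_step)
  have S: "{\<eta> \<in> A. \<eta> k = c} \<in> sets (bernoulli_measure p)" for c
    using A by simp
  have Q: "{\<eta> \<in> A. queue \<eta> k = b} \<in> sets (bernoulli_measure p)"
    using A by simp
  \<comment> \<open>Even with truncated subtraction \<open>a + 1\<close> and \<open>a - 1\<close>
    differ, so the new queue length determines the occupation of \<open>k\<close>.\<close>
  have eq: "prob {\<eta> \<in> A. queue \<eta> k = b} = prob {\<eta> \<in> A. \<eta> k = c}" if "b = (if c then a + 1 else a - 1)" for c
    by (rule measure_eq_AE[OF _ Q S]) (use step in eventually_elim, use that in \<open>auto split: if_splits\<close>)
  consider "b = a + 1" | "b = a - 1" | "b \<noteq> a + 1" "b \<noteq> a - 1" by blast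
  then show ?thesis
  proof cases
    case 1
    then show ?thesis
      using eq[of True] bernoulli_site_independent[OF A indep, of p True] p by (simp add: trans_prob_def)
  next
    case 2
    then show ?thesis
      using eq[of False] bernoulli_site_independent[OF A indep, of p False] p by (simp add: trans_prob_def)
  next
    case 3
    have "prob {\<eta> \<in> A. queue \<eta> k = b} = prob {}"
      by (rule measure_eq_AE[OF _ Q]) (use step in eventually_elim, use 3 in \<open>auto split: if_splits\<close>)
    with 3 show ?thesis by (simp add: trans_prob_def)
  qed
qed

lemma queue_path_prob:
  assumes p: "0 \<le> p" "p < 1 / 2"
  shows "w \<noteq> [] \<Longrightarrow> measure (bernoulli_measure p) {\<eta>. queue_path \<eta> j (length w) = w} =
    queue_prob p (hd w) * path_weight p w"
proof (induction w rule: rev_induct)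
  case (snoc b v)
  show ?case
  proof (cases v rule: rev_cases)
    case Nil
    then show ?thesis by (simp add: queue_path_def queue_prob_shift)
  next
    case (snoc u a)
    define k where "k = j + int (length v)"
    define A where "A = {\<eta>. queue_path \<eta> j (length v) = v}"
    have last: "queue \<eta> (k - 1) = a" if "\<eta> \<in> A" for \<eta>
      using that snoc by (simp add: A_def k_def queue_path_def)
    have indep: "\<eta>(k := c) \<in> A \<longleftrightarrow> \<eta> \<in> A" for \<eta> c
    proof -
      have "queue_path (\<eta>(k := c)) j (length v) = queue_path \<eta> j (length v)"
        by (simp add: queue_path_def k_def queue_fun_upd)
      then show ?thesis by (simp add: A_def)
    qed
    have "A \<in> sets borel" by (simp add: A_def)
    from queue_step_prob[OF p this indep last]
    have "measure (bernoulli_measure p) {\<eta> \<in> A. queue \<eta> k = b} =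
        measure (bernoulli_measure p) A * trans_prob p a b" .
    moreover have "{\<eta> \<in> A. queue \<eta> k = b} = {\<eta>. queue_path \<eta> j (length (v @ [b])) = v @ [b]}"
      by (auto simp: A_def k_def queue_path_def)
    moreover have "measure (bernoulli_measure p) A = queue_prob p (hd v) * path_weight p v"
      using snoc.IH snoc by (simp add: A_def)
    ultimately show ?thesis
      using snoc path_weight_snoc[of p u a b] by (cases u) simp_all
  qed
qed simp

text \<open>By stationarity, the events \<open>queue \<eta> (-1) \<le> q < queue \<eta> 0\<close> and \<open>queue \<eta> 0 \<le> q < queue \<eta> (-1)\<close>
  are equally likely.\<close>
lemma queue_detailed_balance:
  assumes p: "0 \<le> p" "p < 1 / 2"
  shows "queue_prob p a * trans_prob p a b = queue_prob p b * trans_prob p b a"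
proof -
  interpret prob_space "bernoulli_measure p" by (rule prob_space_bernoulli_measure)
  \<comment> \<open>In equilibrium the flow up across the cut between \<open>q\<close> and
    \<open>q + 1\<close> equals the flow down.\<close>
  have cut: "queue_prob p q * p = queue_prob p (q + 1) * (1 - p)" for q
  proof -
    define X where "X = (\<lambda>j. {\<eta>. q < queue \<eta> j})"
    have meas: "X j \<in> sets (bernoulli_measure p)" for j by (simp add: X_def)
    have "prob (X j) = 1 - (\<Sum>i\<le>q. queue_prob p i)" for j
    proof -
      have "prob (space (bernoulli_measure p) - X j) = prob (\<Union>i\<in>{..q}. {\<eta>. queue \<eta> j = i})"
        by (rule arg_cong[of _ _ prob]) (auto simp: X_def)
      also have "\<dots> = (\<Sum>i\<le>q. queue_prob p i)"
        by (subst finite_measure_finite_Union) (auto simp: disjoint_family_on_def queue_prob_shift)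
      finally show ?thesis using prob_compl[OF meas[of j]] by simp
    qed
    then have eq: "prob (X 0) = prob (X (-1))" by simp
    have "prob (X 0 - X (-1)) = prob (X 0) - prob (X 0 \<inter> X (-1))"
      "prob (X (-1) - X 0) = prob (X (-1)) - prob (X 0 \<inter> X (-1))"
      using meas by (simp_all add: finite_measure_Diff' Int_commute)
    then have flow: "prob (X 0 - X (-1)) = prob (X (-1) - X 0)" using eq by simp
    have stationary: "prob {\<eta> \<in> {\<eta>. queue \<eta> (-1) = c}. queue \<eta> 0 = d} = queue_prob p c * trans_prob p c d" for c d
    proof -
      have "prob {\<eta> \<in> {\<eta>. queue \<eta> (-1) = c}. queue \<eta> 0 = d} =
          prob {\<eta>. queue \<eta> (-1) = c} * trans_prob p c d"
        by (rule queue_step_prob[OF p]) (auto simp: queue_fun_upd)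
      then show ?thesis by (simp add: queue_prob_shift)
    qed
    have step: "AE \<eta> in bernoulli_measure p.
        queue \<eta> 0 = queue \<eta> (-1) + 1 \<or> queue \<eta> 0 = queue \<eta> (-1) - 1"
      using AE_bernoulli_stable[OF p]
    proof eventually_elim
      case (elim \<eta>)
      then show ?case using queue_step[of \<eta> 0] by auto
    qed
    have "prob (X 0 - X (-1)) = prob {\<eta> \<in> {\<eta>. queue \<eta> (-1) = q}. queue \<eta> 0 = q + 1}"
      by (rule measure_eq_AE) (use step in eventually_elim, auto simp: X_def)
    moreover have "prob (X (-1) - X 0) = prob {\<eta> \<in> {\<eta>. queue \<eta> (-1) = q + 1}. queue \<eta> 0 = q}"
      by (rule measure_eq_AE) (use step in eventually_elim, auto simp: X_def)
    ultimately show ?thesis using flow unfolding stationary by (simp add: trans_prob_def)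
  qed
  \<comment> \<open>For neighbouring \<open>a\<close> and \<open>b\<close> this is
    \<open>cut\<close>; otherwise both sides vanish or, for \<open>a = b\<close>, coincide.\<close>
  show ?thesis
    using cut[of a] cut[of b] by (auto simp: trans_prob_def)
qed

text \<open>Detailed balance moves the stationary weight along the path one transition at a time,
  reversing each transition that it passes.\<close>

lemma path_weight_rev:
  assumes p: "0 \<le> p" "p < 1 / 2"
  shows "w \<noteq> [] \<Longrightarrow> queue_prob p (hd w) * path_weight p w = queue_prob p (last w) * path_weight p (rev w)"
proof (induction w rule: induct_list012)
  case (3 a b w)
  have "queue_prob p a * path_weight p (a # b # w) = trans_prob p b a * (queue_prob p b * path_weight p (b # w))"
    using queue_detailed_balance[OF p, of a b] by simp
  also have "queue_prob p b * path_weight p (b # w) = queue_prob p (last (b # w)) * path_weight p (rev w @ [b])"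
    using "3.IH"(2) by simp
  finally show ?case by (simp add: path_weight_snoc)
qed simp_all

lemma queue_path_reversible:
  assumes p: "0 \<le> p" "p < 1 / 2"
  shows "distr (bernoulli_measure p) (count_space UNIV) (\<lambda>\<eta>. rev (queue_path \<eta> j n)) =
    distr (bernoulli_measure p) (count_space UNIV) (\<lambda>\<eta>. queue_path \<eta> j n)"
proof (rule measure_eqI_countable[of _ UNIV])
  interpret prob_space "bernoulli_measure p" by (rule prob_space_bernoulli_measure)
  fix w :: "nat list"
  have "prob {\<eta>. rev (queue_path \<eta> j n) = w} = prob {\<eta>. queue_path \<eta> j n = w}"
  proof (cases "length w = n \<and> w \<noteq> []")
    case True
    then have n: "n = length w" "n = length (rev w)" by auto
    have "prob {\<eta>. rev (queue_path \<eta> j n) = w} = prob {\<eta>. queue_path \<eta> j n = rev w}"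
      by (rule arg_cong[of _ _ prob]) auto
    also have "\<dots> = queue_prob p (hd (rev w)) * path_weight p (rev w)"
      unfolding n(2) using True by (intro queue_path_prob[OF p]) simp
    also have "\<dots> = queue_prob p (hd w) * path_weight p w"
      using True path_weight_rev[OF p, of w] by (simp add: hd_rev)
    also have "\<dots> = prob {\<eta>. queue_path \<eta> j n = w}"
      unfolding n(1) using True by (intro queue_path_prob[OF p, symmetric]) simp
    finally show ?thesis .
  next
    case False
    have "length (queue_path \<eta> j n) = n" for \<eta> by (simp add: queue_path_def)
    \<comment> \<open>A list of the wrong length makes both sides false; the empty list is its own
      reversal.\<close>
    then have "rev (queue_path \<eta> j n) = w \<longleftrightarrow> queue_path \<eta> j n = w" for \<eta>
      using False by (metis length_0_conv length_rev rev.simps(1))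
    then show ?thesis by simp
  qed
  then show "emeasure (distr (bernoulli_measure p) (count_space UNIV) (\<lambda>\<eta>. rev (queue_path \<eta> j n))) {w} =
      emeasure (distr (bernoulli_measure p) (count_space UNIV) (\<lambda>\<eta>. queue_path \<eta> j n)) {w}"
    by (simp add: emeasure_distr vimage_def emeasure_eq_measure)
qed simp_all

text \<open>A cylinder event of the final configuration depends on the queue path over a window
  symmetric about 0, and reflecting the configuration reverses that path.\<close>

lemma reflect_final_bernoulli:
  assumes p: "0 \<le> p" "p < 1 / 2"
  shows "push reflect (push final_config (bernoulli_measure p)) = push final_config (bernoulli_measure p)"
proof (rule config_measure_eqI)
  interpret prob_space "push reflect (push final_config (bernoulli_measure p))"
    using config_prob_push[OF config_prob_push[OF config_prob_bernoulli_measure]]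
    by (simp add: config_prob_def)
  show "finite_measure (push reflect (push final_config (bernoulli_measure p)))"
    by (rule finite_measure_axioms)
  fix J :: "int set" and A :: "int \<Rightarrow> bool set"
  assume J: "finite J"
  \<comment> \<open>Inserting 0 keeps the maximum defined for empty \<open>J\<close>; the window
    \<open>-N..N\<close> has \<open>2 * N + 1\<close> sites.\<close>
  define N where "N = Max (insert 0 (abs ` J))"
  have N: "\<bar>j\<bar> \<le> N" if "j \<in> J" for j
    using J that by (simp add: N_def)
  define n where "n = nat (2 * N + 1)"
  define S where "S = {w :: nat list. \<forall>j\<in>J. odd (w ! nat (j + N)) \<in> A j}"
  have nth: "queue_path \<eta> (- N) n ! nat (j + N) = queue \<eta> j"
    "rev (queue_path \<eta> (- N) n) ! nat (j + N) = queue \<eta> (- j)" if "j \<in> J" for \<eta> j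
  proof -
    have nonneg: "0 \<le> j + N" "0 \<le> N - j" using N[OF that] by auto
    then have lt: "nat (j + N) < n" using N[OF that] by (simp add: n_def)
    then show "queue_path \<eta> (- N) n ! nat (j + N) = queue \<eta> j"
      using nonneg by (simp add: queue_path_def)
    \<comment> \<open>Position \<open>N - j\<close> in a path starting at \<open>-N\<close> belongs
      to site \<open>-j\<close>.\<close>
    have "n - Suc (nat (j + N)) = nat (N - j)" using N[OF that] by (simp add: n_def)
    moreover have "nat (N - j) < n" using N[OF that] by (simp add: n_def)
    ultimately show "rev (queue_path \<eta> (- N) n) ! nat (j + N) = queue \<eta> (- j)"
      using lt nonneg by (simp add: rev_nth queue_path_def)
  qed
  have meas: "final_config \<in> borel_measurable (bernoulli_measure p)"
    "reflect \<circ> final_config \<in> borel_measurable (bernoulli_measure p)"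
    by measurable
  have "emeasure (push reflect (push final_config (bernoulli_measure p))) {\<eta>. \<forall>j\<in>J. \<eta> j \<in> A j} =
      emeasure (bernoulli_measure p) {\<eta>. rev (queue_path \<eta> (- N) n) \<in> S}"
    unfolding push_push[OF sets_bernoulli_measure measurable_reflect measurable_final_config]
    unfolding push_def using meas(2) measurable_cylinder[OF J, of A]
    by (subst emeasure_distr) (auto simp: vimage_def S_def nth final_config_def reflect_def)
  also have "\<dots> = emeasure (distr (bernoulli_measure p) (count_space UNIV)
      (\<lambda>\<eta>. rev (queue_path \<eta> (- N) n))) S"
    by (subst emeasure_distr) (auto simp: vimage_def)
  also have "\<dots> = emeasure (bernoulli_measure p) {\<eta>. queue_path \<eta> (- N) n \<in> S}"
    unfolding queue_path_reversible[OF p] by (subst emeasure_distr) (auto simp: vimage_def)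
  also have "\<dots> = emeasure (push final_config (bernoulli_measure p)) {\<eta>. \<forall>j\<in>J. \<eta> j \<in> A j}"
    unfolding push_def using meas(1) measurable_cylinder[OF J, of A]
    by (subst emeasure_distr) (auto simp: vimage_def S_def nth final_config_def)
  finally show "emeasure (push reflect (push final_config (bernoulli_measure p))) {\<eta>. \<forall>j\<in>J. \<eta> j \<in> A j} = \<dots>" .
qed simp_all

section \<open>Particle-hole exchange and the final assembly\<close>

lemma weak_limit_exchange:
  assumes T: "\<And>\<eta>. T (exchange \<eta>) = exchange (T' \<eta>)" and meas: "T \<in> borel_measurable borel" "T' \<in> borel_measurable borel"
    and sets: "sets \<nu> = sets borel" and lim: "weak_limit (\<lambda>t. push (T' ^^ t) \<nu>) L"
  shows "weak_limit (\<lambda>t. push (T ^^ t) (push exchange \<nu>)) (push exchange L)"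
proof -
  have "push (T ^^ t) (push exchange \<nu>) = push exchange (push (T' ^^ t) \<nu>)" for t
  proof -
    have "(T ^^ t) \<circ> exchange = exchange \<circ> (T' ^^ t)"
      by (simp add: fun_eq_iff funpow_intertwine[of T exchange T', OF T])
    then show ?thesis using sets meas by (simp add: push_push measurable_funpow_config)
  qed
  then show ?thesis using weak_limit_push_continuous[OF lim continuous_exchange] by simp
qed

theorem mainTheorem9:
  fixes \<rho> :: real
  assumes "0 < \<rho>" and "\<rho> < 1 / 2"
  shows
    "(\<forall>\<eta>0 \<in> density_configs \<rho>. \<exists>\<eta>inf.
        pointwise_limit (\<lambda>t. (ftasep ^^ t) \<eta>0) \<eta>inf \<and>
        pointwise_limit (\<lambda>t. ((translate \<circ> tasepL) ^^ t) \<eta>0) \<eta>inf)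
     \<and>
     (\<forall>\<nu>. config_prob \<nu> \<and> translation_invariant \<nu> \<and> measure \<nu> (density_configs \<rho>) = 1 \<longrightarrow>
        (\<exists>\<nu>inf \<nu>Rinf.
           weak_limit (\<lambda>t. push (ftasep ^^ t) \<nu>) \<nu>inf \<and>
           weak_limit (\<lambda>t. push (ftasep ^^ t) (push reflect \<nu>)) \<nu>Rinf \<and>
           weak_limit (\<lambda>t. push (tasepL ^^ t) \<nu>) \<nu>inf \<and>
           weak_limit (\<lambda>t. push (tasepR ^^ t) \<nu>) (push reflect \<nu>Rinf)))
     \<and>
     (\<exists>\<mu>inf.
        weak_limit (\<lambda>t. push (ftasep ^^ t) (bernoulli_measure \<rho>)) \<mu>inf \<and>
        (\<forall>T \<in> {tasepL, tasepR}.
           weak_limit (\<lambda>t. push (T ^^ t) (bernoulli_measure \<rho>)) \<mu>inf \<and>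
           weak_limit (\<lambda>t. push (T ^^ t) (bernoulli_measure (1 - \<rho>))) (push exchange \<mu>inf)))"
proof (intro conjI)
  show "\<forall>\<eta>0 \<in> density_configs \<rho>. \<exists>\<eta>inf.
      pointwise_limit (\<lambda>t. (ftasep ^^ t) \<eta>0) \<eta>inf \<and>
      pointwise_limit (\<lambda>t. ((translate \<circ> tasepL) ^^ t) \<eta>0) \<eta>inf"
    using pointwise_limit_ftasep_density pointwise_limit_tasepL[OF density_imp_stable] assms(2)
    by blast
  show "\<forall>\<nu>. config_prob \<nu> \<and> translation_invariant \<nu> \<and> measure \<nu> (density_configs \<rho>) = 1 \<longrightarrow>
      (\<exists>\<nu>inf \<nu>Rinf.
         weak_limit (\<lambda>t. push (ftasep ^^ t) \<nu>) \<nu>inf \<and>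
         weak_limit (\<lambda>t. push (ftasep ^^ t) (push reflect \<nu>)) \<nu>Rinf \<and>
         weak_limit (\<lambda>t. push (tasepL ^^ t) \<nu>) \<nu>inf \<and>
         weak_limit (\<lambda>t. push (tasepR ^^ t) \<nu>) (push reflect \<nu>Rinf))"
  proof (intro allI impI, elim conjE)
    fix \<nu>
    assume \<nu>: "config_prob \<nu>" "translation_invariant \<nu>" "measure \<nu> (density_configs \<rho>) = 1"
    note AE = AE_density_of_measure_1[OF \<nu>(1,3)]
    have "config_prob (push reflect \<nu>)" using \<nu>(1) by (rule config_prob_push) simp
    then show "\<exists>\<nu>inf \<nu>Rinf.
         weak_limit (\<lambda>t. push (ftasep ^^ t) \<nu>) \<nu>inf \<and>
         weak_limit (\<lambda>t. push (ftasep ^^ t) (push reflect \<nu>)) \<nu>Rinf \<and>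
         weak_limit (\<lambda>t. push (tasepL ^^ t) \<nu>) \<nu>inf \<and>
         weak_limit (\<lambda>t. push (tasepR ^^ t) \<nu>) (push reflect \<nu>Rinf)"
      using weak_limit_ftasep[OF \<nu>(1) AE(1) assms(2)] weak_limit_ftasep[OF _ AE(2) assms(2)]
        weak_limit_tasepL[OF \<nu>(1,2) AE(1) assms(2)] weak_limit_tasepR[OF \<nu>(1,2) AE(2) assms(2)]
      by blast
  qed
  let ?\<mu> = "bernoulli_measure \<rho>" and ?\<mu>inf = "push final_config (bernoulli_measure \<rho>)"
  have AE: "AE \<eta> in ?\<mu>. \<eta> \<in> density_configs \<rho>"
    using assms by (intro AE_bernoulli_density) auto
  note prob = config_prob_bernoulli_measure[of \<rho>] and inv = translation_invariant_bernoulli[of \<rho>]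
  have L: "weak_limit (\<lambda>t. push (tasepL ^^ t) ?\<mu>) ?\<mu>inf"
    by (rule weak_limit_tasepL[OF prob inv AE assms(2)])
  \<comment> \<open>The Bernoulli measure and the law of its final configuration are both reflection
    invariant, so both reflections in the rightward limit disappear.\<close>
  have R: "weak_limit (\<lambda>t. push (tasepR ^^ t) ?\<mu>) ?\<mu>inf"
    using weak_limit_tasepR[OF prob inv, unfolded push_reflect_bernoulli, OF AE assms(2)] assms
    by (simp add: reflect_final_bernoulli)
  have ex: "push exchange ?\<mu> = bernoulli_measure (1 - \<rho>)"
    using assms by (intro push_exchange_bernoulli) auto
  \<comment> \<open>The exchange reverses the direction, so the leftward limit at density
    \<open>1 - \<rho>\<close> comes from the rightward one at density \<open>\<rho>\<close>, and
    conversely.\<close>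
  have "weak_limit (\<lambda>t. push (tasepL ^^ t) (bernoulli_measure (1 - \<rho>))) (push exchange ?\<mu>inf)"
    unfolding ex[symmetric] by (rule weak_limit_exchange[OF tasepL_exchange _ _ _ R]) simp_all
  moreover have "weak_limit (\<lambda>t. push (tasepR ^^ t) (bernoulli_measure (1 - \<rho>))) (push exchange ?\<mu>inf)"
    unfolding ex[symmetric] by (rule weak_limit_exchange[OF tasepR_exchange _ _ _ L]) simp_all
  ultimately show "\<exists>\<mu>inf.
      weak_limit (\<lambda>t. push (ftasep ^^ t) ?\<mu>) \<mu>inf \<and>
      (\<forall>T \<in> {tasepL, tasepR}.
         weak_limit (\<lambda>t. push (T ^^ t) ?\<mu>) \<mu>inf \<and>
         weak_limit (\<lambda>t. push (T ^^ t) (bernoulli_measure (1 - \<rho>))) (push exchange \<mu>inf))"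
    using weak_limit_ftasep[OF prob AE assms(2)] L R by blast
qed

end
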